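(* Let $n\ge1$ be an integer, let $0<\alpha_0<\alpha_1<\alpha_2\le1$, $p_0\ge1$ and $1\le p_2<\infty$ be such that $\alpha_0-\frac1{p_0}<\alpha_2-\frac1{p_2}$, and let $p_1$ be given by $$\frac1{p_1}=\frac{\theta}{p_0}+\frac{1-\theta}{p_2},\qquad \theta=\frac{\alpha_2-\alpha_1}{\alpha_2-\alpha_0}.$$ Then there is a constant $C>0$ such that $$\|f\|_{\dot W^{\alpha_1,p_1}}\le C\,\|f\|_{\dot W^{\alpha_0,p_0}}^{\frac{\alpha_2-\alpha_1}{\alpha_2-\alpha_0}}\,\|f\|_{\dot W^{\alpha_2,p_2}}^{\frac{\alpha_1-\alpha_0}{\alpha_2-\alpha_0}}\qquad\text{for all } f\in\dot W^{\alpha_0,p_0}(\mathbb{R}^n)\cap\dot W^{\alpha_2,p_2}(\mathbb{R}^n).$$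
   Context: For $0<\alpha<1$ and $1\le p<\infty$, $$\|f\|_{\dot W^{\alpha,p}}=\left(\int_{\mathbb{R}^n}\int_{\mathbb{R}^n}\frac{|f(x+h)-f(x)|^p}{|h|^{n+\alpha p}}\,dh\,dx\right)^{1/p},$$ and for $\alpha=1$, $\|f\|_{\dot W^{1,p}}=\|Df\|_{L^p}$, where $Df$ is the weak gradient. Membership $f\in\dot W^{\alpha,p}(\mathbb{R}^n)$ means that this quantity is finite. *)

theory Defs
  imports "HOL-Analysis.Analysis"
begin

(* Intended for r > 0, so that powr sends 0 to 0. *)
definition ennreal_powr :: "ennreal \<Rightarrow> real \<Rightarrow> ennreal" where
  "ennreal_powr x r = (if x = top then top else ennreal (enn2real x powr r))"

definition locally_integrable :: "(real^'n \<Rightarrow> 'b::euclidean_space) \<Rightarrow> bool" where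
  "locally_integrable f \<longleftrightarrow> (\<forall>K. compact K \<longrightarrow> f absolutely_integrable_on K)"

definition partial_derivative :: "'n \<Rightarrow> (real^'n \<Rightarrow> real) \<Rightarrow> real^'n \<Rightarrow> real" where
  "partial_derivative i \<phi> x = frechet_derivative \<phi> (at x) (axis i 1)"

primrec C_k :: "nat \<Rightarrow> (real^'n \<Rightarrow> real) \<Rightarrow> bool" where
  "C_k 0 \<phi> \<longleftrightarrow> continuous_on UNIV \<phi>"
| "C_k (Suc k) \<phi> \<longleftrightarrow> (\<forall>x. \<phi> differentiable (at x)) \<and> (\<forall>i. C_k k (partial_derivative i \<phi>))"

definition test_function :: "(real^'n \<Rightarrow> real) \<Rightarrow> bool" where
  "test_function \<phi> \<longleftrightarrow> (\<forall>k. C_k k \<phi>) \<and> compact (closure {x. \<phi> x \<noteq> 0})"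

definition has_weak_gradient :: "(real^'n \<Rightarrow> real) \<Rightarrow> (real^'n \<Rightarrow> real^'n) \<Rightarrow> bool" where
  "has_weak_gradient f G \<longleftrightarrow>
     locally_integrable f \<and> locally_integrable G \<and>
     (\<forall>\<phi> i. test_function \<phi> \<longrightarrow>
        (LINT x|lebesgue. f x * partial_derivative i \<phi> x) = - (LINT x|lebesgue. G x $ i * \<phi> x))"

(* The weak gradient is unique only up to null sets; the choice of representative
   does not affect the integrals below. *)
definition weak_gradient :: "(real^'n \<Rightarrow> real) \<Rightarrow> real^'n \<Rightarrow> real^'n" where
  "weak_gradient f = (SOME G. has_weak_gradient f G)"

definition Lp_norm :: "real \<Rightarrow> (real^'n \<Rightarrow> 'b::real_normed_vector) \<Rightarrow> ennreal" where
  "Lp_norm p g = ennreal_powr (\<integral>\<^sup>+x. ennreal (norm (g x) powr p) \<partial>lebesgue) (1 / p)"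

definition gagliardo_seminorm :: "real \<Rightarrow> real \<Rightarrow> (real^'n \<Rightarrow> real) \<Rightarrow> ennreal" where
  "gagliardo_seminorm \<alpha> p f =
     ennreal_powr
       (\<integral>\<^sup>+x. (\<integral>\<^sup>+h. ennreal (\<bar>f (x + h) - f x\<bar> powr p / norm h powr (real CARD('n) + \<alpha> * p))
          \<partial>lebesgue) \<partial>lebesgue)
       (1 / p)"

(* Takes the value top on functions without a weak gradient when \<alpha> = 1.
   Meaningful for 0 < \<alpha> \<le> 1 and 1 \<le> p. *)
definition sobolev_seminorm :: "real \<Rightarrow> real \<Rightarrow> (real^'n \<Rightarrow> real) \<Rightarrow> ennreal" where
  "sobolev_seminorm \<alpha> p f =
     (if \<alpha> = 1
      then (if \<exists>G. has_weak_gradient f G then Lp_norm p (weak_gradient f) else top)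
      else gagliardo_seminorm \<alpha> p f)"

(* Functions are not identified when they agree almost everywhere. *)
definition sobolev_space :: "real \<Rightarrow> real \<Rightarrow> (real^'n \<Rightarrow> real) set" where
  "sobolev_space \<alpha> p = {f. f \<in> borel_measurable lebesgue \<and> sobolev_seminorm \<alpha> p f < top}"

end

theory Submission
  imports Defs "HOL-Computational_Algebra.Polynomial"
begin

text \<open>With \<open>K\<^sub>i = \<bar>f (x + h) - f x\<bar> powr p\<^sub>i / norm h powr (n + \<alpha>\<^sub>i * p\<^sub>i)\<close> one has
  \<open>K\<^sub>1 = K\<^sub>0 powr \<sigma> * K\<^sub>2 powr (1 - \<sigma>)\<close> where \<open>\<sigma> = \<theta> * p\<^sub>1 / p\<^sub>0\<close>. To interpolate, it suffices to control the integral
  of \<open>K\<^sub>2\<close> over each shell \<open>\<Lambda> * K\<^sub>2 < K\<^sub>0 \<le> 2 * \<Lambda> * K\<^sub>2\<close> uniformly in \<open>\<Lambda>\<close>, a weak-type substitute for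
  the integral of \<open>K\<^sub>2\<close>, which for \<open>\<alpha>\<^sub>2 = 1\<close> is infinite unless \<open>f\<close> is constant. In that case, if \<open>p\<^sub>0 \<noteq> p\<^sub>2\<close>, the shells are the level sets of
  \<open>\<bar>f (x + h) - f x\<bar> powr p\<^sub>2 / norm h powr (p\<^sub>2 + \<gamma>)\<close> with \<open>\<gamma> = (1 - \<alpha>\<^sub>0) / (1 / p\<^sub>0 - 1 / p\<^sub>2)\<close>. This quotient is at most
  \<open>norm h powr (-\<gamma>)\<close> times the mean of \<open>norm (Df) powr p\<^sub>2\<close> over the segment from \<open>x\<close> to \<open>x + h\<close>, and bisecting
  the segment repeatedly gives a weak-type bound for such means with respect to the measure
  \<open>norm h powr (\<gamma> - n) dh dx\<close> when \<open>\<gamma> \<notin> [-1, 0]\<close>. The hypothesis relating \<open>\<alpha>\<^sub>0 - 1 / p\<^sub>0\<close> and \<open>\<alpha>\<^sub>2 - 1 / p\<^sub>2\<close>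
  says exactly this about \<open>\<gamma>\<close>.\<close>

section \<open>Interpolation through dyadic shells\<close>

text \<open>The shells act like a weak endpoint of an interpolation: where
  \<open>K\<^sub>0 > \<Lambda> * K\<^sub>2\<close> the integral of \<open>K\<^sub>0\<close>
  suffices, and below that level the shells carry the weights
  \<open>(\<Lambda> / 2 ^ k) powr \<sigma>\<close>, a convergent series. The interval [-1, 0] comes
  from counting in the bisection. Relative to the whole segment, one subsegment of generation i
  weighs 2^(-i(\<gamma>+1)) and a full generation 2^(-i\<gamma>). For \<gamma> > 0 both decay and
  the longest exceeding segments dominate; for \<gamma> < -1 both grow and the shortest dominate.
  For \<gamma> in [-1, 0] a single chain does not grow and a full generation does not decay, so
  neither end of the tree controls the sum. If \<open>p\<^sub>0 = p\<^sub>2\<close>, the quotient of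
  the kernels depends on \<open>norm h\<close> alone and the shells are annuli. A weak gradient is
  known only through test functions. The formula for \<open>f (x + h) - f x\<close> is therefore
  obtained by duality, with the translation moved to the test function; no smooth approximation of
  \<open>f\<close> occurs.\<close>

definition shell_const :: "real \<Rightarrow> real" where
  "shell_const \<sigma> = 1 + 1 / (1 - 2 powr (-\<sigma>))"

lemma shell_const_pos: "0 < \<sigma> \<Longrightarrow> 0 < shell_const \<sigma>"
  using powr_less_mono[of "-\<sigma>" 0 "2::real"] by (simp add: shell_const_def add_pos_pos)

text \<open>If \<open>a > \<Lambda> * b\<close>, replacing \<open>b\<close> by
  \<open>a / \<Lambda>\<close> gives the first term. Otherwise, for positive \<open>a\<close> and
  \<open>b\<close>, the ratio \<open>a / b\<close> lies in one interval from
  \<open>\<Lambda> / 2 ^ Suc k\<close> (excluded) to \<open>\<Lambda> / 2 ^ k\<close>, and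
  \<open>a powr \<sigma>\<close> is at most
  \<open>(\<Lambda> / 2 ^ k * b) powr \<sigma>\<close>.\<close>

lemma geometric_mean_le_dyadic_shells:
  fixes a b \<sigma> \<Lambda> :: real
  assumes \<sigma>: "0 < \<sigma>" "\<sigma> < 1" and a: "0 \<le> a" and b: "0 \<le> b" and \<Lambda>: "0 < \<Lambda>"
  shows "ennreal (a powr \<sigma> * b powr (1 - \<sigma>)) \<le>
    ennreal (\<Lambda> powr (\<sigma> - 1)) * ennreal a +
    (\<Sum>k. ennreal ((\<Lambda> / 2 ^ k) powr \<sigma>) *
       (if \<Lambda> / 2 ^ Suc k * b < a \<and> a \<le> 2 * (\<Lambda> / 2 ^ Suc k) * b then ennreal b else 0))"
    (is "?l \<le> ?r1 + suminf ?f")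
proof (cases "a = 0 \<or> b = 0")
  case True
  then show ?thesis by auto
next
  case False
  then have a: "a > 0" and b: "b > 0" using a b by auto
  show ?thesis
  proof (cases "a > \<Lambda> * b")
    case True
    have "a powr \<sigma> * b powr (1 - \<sigma>) \<le> a powr \<sigma> * (a / \<Lambda>) powr (1 - \<sigma>)"
      using True a b \<Lambda> \<sigma> by (intro mult_left_mono powr_mono2) (auto simp: field_simps)
    also have "\<dots> = a powr (\<sigma> + (1 - \<sigma>)) * \<Lambda> powr (\<sigma> - 1)"
      using a \<Lambda> powr_minus[of \<Lambda> "1 - \<sigma>"] unfolding powr_add by (simp add: powr_divide field_simps)
    finally have "a powr \<sigma> * b powr (1 - \<sigma>) \<le> \<Lambda> powr (\<sigma> - 1) * a"
      using a by (simp add: mult.commute)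
    then have "?l \<le> ?r1"
      using a by (simp flip: ennreal_mult)
    also have "?r1 \<le> ?r1 + suminf ?f" by simp
    finally show ?thesis .
  next
    case False
    \<comment> \<open>\<open>P k\<close> says \<open>\<Lambda> / 2 ^ k < a / b\<close>. It fails at
      0 by the case assumption, so there is a step at which it becomes true, and this step names the
      shell.\<close>
    define P where "P k \<longleftrightarrow> \<Lambda> * b < a * 2 ^ k" for k
    obtain k0 where "P k0"
    proof -
      obtain k :: nat where "\<Lambda> * b / a < 2 ^ k"
        using real_arch_pow[of 2 "\<Lambda> * b / a"] by auto
      then show thesis using a that[of k] by (auto simp: P_def field_simps)
    qed
    moreover have "\<not> P 0" using False by (simp add: P_def)
    ultimately obtain k where k: "\<not> P k" "P (Suc k)"
      using ex_least_nat_less[of P] by blast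
    have c: "\<Lambda> / 2 ^ Suc k * b < a" "a \<le> 2 * (\<Lambda> / 2 ^ Suc k) * b"
      using k by (auto simp: P_def field_simps)
    have "a powr \<sigma> * b powr (1 - \<sigma>) \<le> (\<Lambda> / 2 ^ k * b) powr \<sigma> * b powr (1 - \<sigma>)"
      using c a b \<sigma> by (intro mult_right_mono powr_mono2) auto
    also have "\<dots> = (\<Lambda> / 2 ^ k) powr \<sigma> * b powr (\<sigma> + (1 - \<sigma>))"
      using b \<Lambda> unfolding powr_add by (simp add: powr_mult[of "\<Lambda> / 2 ^ k"] del: times_divide_eq_left)
    finally have "?l \<le> ennreal ((\<Lambda> / 2 ^ k) powr \<sigma>) * ennreal b"
      using b by (simp flip: ennreal_mult)
    also have "\<dots> = ?f k" using c by simp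
    also have "\<dots> \<le> suminf ?f"
      using sum_le_suminf[of ?f "{k}"] by simp
    also have "\<dots> \<le> ?r1 + suminf ?f" by simp
    finally show ?thesis .
  qed
qed

lemma suminf_dyadic_powr:
  fixes \<sigma> \<Lambda> :: real
  assumes "0 < \<sigma>" "0 < \<Lambda>"
  shows "(\<Sum>k. ennreal ((\<Lambda> / 2 ^ k) powr \<sigma>)) = ennreal (\<Lambda> powr \<sigma> / (1 - 2 powr (-\<sigma>)))"
proof -
  have q: "2 powr (-\<sigma>) < 1" using assms by (simp add: powr_minus_divide)
  have "(\<Lambda> / 2 ^ k) powr \<sigma> = \<Lambda> powr \<sigma> * (2 powr (-\<sigma>)) ^ k" for k
    using assms by (simp add: powr_divide powr_minus_divide powr_realpow[symmetric] powr_powr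
        mult.commute power_one_over divide_simps)
  moreover have "(\<lambda>k. \<Lambda> powr \<sigma> * (2 powr (-\<sigma>)) ^ k) sums (\<Lambda> powr \<sigma> * (1 / (1 - 2 powr (-\<sigma>))))"
    using q by (intro sums_mult geometric_sums) auto
  ultimately show ?thesis
    by (intro suminf_ennreal_eq) auto
qed

text \<open>No integral of \<open>b\<close> enters, only the uniform bound \<open>K\<close> on its
  shells. Splitting at level \<open>\<Lambda>\<close> gives
  \<open>\<Lambda> powr (\<sigma> - 1) * A\<close> plus the geometric series
  \<open>\<Lambda> powr \<sigma> * K / (1 - 2 powr (-\<sigma>))\<close>. For
  \<open>\<Lambda> = A / K\<close> both are multiples of
  \<open>A powr \<sigma> * K powr (1 - \<sigma>)\<close>, and \<open>shell_const\<close> is the sum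
  of the two factors.\<close>

lemma nn_integral_geometric_mean_le:
  fixes a b :: "'a \<Rightarrow> real" and \<sigma> A K :: real
  assumes \<sigma>: "0 < \<sigma>" "\<sigma> < 1"
    and [measurable]: "a \<in> borel_measurable M" "b \<in> borel_measurable M"
    and nonneg: "\<And>x. 0 \<le> a x" "\<And>x. 0 \<le> b x"
    and A: "0 \<le> A" "(\<integral>\<^sup>+x. ennreal (a x) \<partial>M) \<le> ennreal A"
    and K: "0 \<le> K" "\<And>\<Lambda>. 0 < \<Lambda> \<Longrightarrow>
      (\<integral>\<^sup>+x. (if \<Lambda> * b x < a x \<and> a x \<le> 2 * \<Lambda> * b x then ennreal (b x) else 0) \<partial>M) \<le> ennreal K"
  shows "(\<integral>\<^sup>+x. ennreal (a x powr \<sigma> * b x powr (1 - \<sigma>)) \<partial>M) \<le>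
    ennreal (shell_const \<sigma> * A powr \<sigma> * K powr (1 - \<sigma>))" (is "?I \<le> _")
proof -
  define c where "c = 1 / (1 - 2 powr (-\<sigma>))"
  have c: "c \<ge> 0" using \<sigma> powr_mono[of "-\<sigma>" 0 "2::real"] by (simp add: c_def)
  \<comment> \<open>The enlarged bounds \<open>A'\<close> and \<open>K'\<close> leave room to keep
    the level positive and finite when it is optimised.\<close>
  have split: "?I \<le> ennreal (\<Lambda> powr (\<sigma> - 1) * A' + \<Lambda> powr \<sigma> * c * K')"
    if "0 < \<Lambda>" "A \<le> A'" "K \<le> K'" for \<Lambda> A' K'
  proof -
    let ?S = "\<lambda>k x. (if \<Lambda> / 2 ^ Suc k * b x < a x \<and> a x \<le> 2 * (\<Lambda> / 2 ^ Suc k) * b x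
      then ennreal (b x) else 0)"
    have "?I \<le> (\<integral>\<^sup>+x. ennreal (\<Lambda> powr (\<sigma> - 1)) * ennreal (a x) +
        (\<Sum>k. ennreal ((\<Lambda> / 2 ^ k) powr \<sigma>) * ?S k x) \<partial>M)"
      using nonneg by (intro nn_integral_mono geometric_mean_le_dyadic_shells \<sigma> that)
    also have "\<dots> = ennreal (\<Lambda> powr (\<sigma> - 1)) * (\<integral>\<^sup>+x. ennreal (a x) \<partial>M) +
        (\<Sum>k. ennreal ((\<Lambda> / 2 ^ k) powr \<sigma>) * (\<integral>\<^sup>+x. ?S k x \<partial>M))"
      by (subst nn_integral_add) (auto simp: nn_integral_cmult nn_integral_suminf)
    also have "\<dots> \<le> ennreal (\<Lambda> powr (\<sigma> - 1)) * ennreal A' +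
        (\<Sum>k. ennreal ((\<Lambda> / 2 ^ k) powr \<sigma>) * ennreal K')"
    proof (intro add_mono mult_left_mono suminf_le)
      show "(\<integral>\<^sup>+x. ennreal (a x) \<partial>M) \<le> ennreal A'"
        using A that by (meson ennreal_leI order_trans)
      show "(\<integral>\<^sup>+x. ?S k x \<partial>M) \<le> ennreal K'" for k
        using K(2)[of "\<Lambda> / 2 ^ Suc k"] that by (meson ennreal_leI order_trans divide_pos_pos
            zero_less_power zero_less_numeral)
    qed auto
    also have "(\<Sum>k. ennreal ((\<Lambda> / 2 ^ k) powr \<sigma>) * ennreal K') = ennreal (\<Lambda> powr \<sigma> * c) * ennreal K'"
      unfolding ennreal_suminf_multc suminf_dyadic_powr[OF \<sigma>(1) that(1)] c_def by simp
    finally show ?thesis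
      using that A K c by (simp add: ennreal_mult ennreal_plus)
  qed
  \<comment> \<open>The optimal \<open>\<Lambda>\<close> is \<open>A / K\<close>; the perturbation by \<open>\<epsilon>\<close> covers \<open>A = 0\<close> and \<open>K = 0\<close>.\<close>
  have bound: "?I \<le> ennreal (shell_const \<sigma> * (A + \<epsilon>) powr \<sigma> * (K + \<epsilon>) powr (1 - \<sigma>))" if \<epsilon>: "\<epsilon> > 0" for \<epsilon>
  proof -
    let ?A = "A + \<epsilon>" and ?K = "K + \<epsilon>"
    have pos: "?A > 0" "?K > 0" using A K \<epsilon> by auto
    have "?I \<le> ennreal ((?A / ?K) powr (\<sigma> - 1) * ?A + (?A / ?K) powr \<sigma> * c * ?K)"
      using pos \<epsilon> by (intro split) auto
    also have "(?A / ?K) powr (\<sigma> - 1) * ?A = ?A powr \<sigma> * ?K powr (1 - \<sigma>)"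
      using pos powr_add[of ?A "\<sigma> - 1" 1] powr_minus[of ?K "1 - \<sigma>"] by (simp add: powr_divide field_simps)
    also have "(?A / ?K) powr \<sigma> * c * ?K = c * ?A powr \<sigma> * ?K powr (1 - \<sigma>)"
      using pos powr_add[of ?K "1 - \<sigma>" \<sigma>] by (simp add: powr_divide field_simps)
    finally show ?thesis by (simp add: shell_const_def c_def algebra_simps)
  qed
  have "((\<lambda>\<epsilon>. ennreal (shell_const \<sigma> * (A + \<epsilon>) powr \<sigma> * (K + \<epsilon>) powr (1 - \<sigma>))) \<longlongrightarrow>
      ennreal (shell_const \<sigma> * (A + 0) powr \<sigma> * (K + 0) powr (1 - \<sigma>))) (at_right 0)"
    using A K \<sigma> by (intro tendsto_ennrealI tendsto_intros tendsto_powr')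
      (auto simp: eventually_at_right_less eventually_at_filter)
  then have "?I \<le> ennreal (shell_const \<sigma> * (A + 0) powr \<sigma> * (K + 0) powr (1 - \<sigma>))"
    by (rule tendsto_lowerbound) (auto simp: eventually_at_filter bound)
  then show ?thesis by simp
qed

section \<open>Weak-type bound for means over segments\<close>

lemma nn_integral_lborel_translate:
  fixes c :: "'a::euclidean_space"
  assumes [measurable]: "F \<in> borel_measurable borel"
  shows "(\<integral>\<^sup>+x. F (x + c) \<partial>lborel) = (\<integral>\<^sup>+x. F x \<partial>lborel)"
proof -
  have "(\<integral>\<^sup>+x. F x \<partial>lborel) = (\<integral>\<^sup>+x. F x \<partial>distr lborel borel ((+) c))"
    by (simp add: lborel_distr_plus)
  then show ?thesis by (simp add: nn_integral_distr add.commute)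
qed

lemma nn_integral_lborel_scaleR:
  fixes F :: "'a::euclidean_space \<Rightarrow> ennreal"
  assumes [measurable]: "F \<in> borel_measurable borel" and "c \<noteq> 0"
  shows "(\<integral>\<^sup>+x. F x \<partial>lborel) = ennreal (\<bar>c\<bar> ^ DIM('a)) * (\<integral>\<^sup>+x. F (c *\<^sub>R x) \<partial>lborel)"
  by (subst lborel_affine[OF \<open>c \<noteq> 0\<close>, of 0])
    (simp add: nn_integral_density nn_integral_distr nn_integral_cmult)

text \<open>The half-open parameter interval is the disjoint union of two half-open halves, so
  bisection is an exact identity. Values in \<open>ennreal\<close> spare any integrability condition
  on \<open>g\<close>.\<close>

definition segment_mean :: "('a::euclidean_space \<Rightarrow> ennreal) \<Rightarrow> 'a \<Rightarrow> 'a \<Rightarrow> ennreal" where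
  "segment_mean g x h = (\<integral>\<^sup>+t\<in>{0<..1}. g (x + t *\<^sub>R h) \<partial>lborel)"

lemma borel_measurable_segment_mean [measurable]:
  assumes [measurable]: "g \<in> borel_measurable borel" "X \<in> borel_measurable M" "H \<in> borel_measurable M"
  shows "(\<lambda>y. segment_mean g (X y) (H y)) \<in> borel_measurable M"
  unfolding segment_mean_def by measurable

lemma segment_mean_bisect:
  fixes x h :: "'a::euclidean_space"
  assumes [measurable]: "g \<in> borel_measurable borel"
  shows "segment_mean g x h =
    (segment_mean g x (h /\<^sub>R 2) + segment_mean g (x + h /\<^sub>R 2) (h /\<^sub>R 2)) / 2"
proof -
  have "segment_mean g x h = (\<integral>\<^sup>+t\<in>{0<..1/2}. g (x + t *\<^sub>R h) \<partial>lborel) +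
      (\<integral>\<^sup>+t\<in>{1/2<..1}. g (x + t *\<^sub>R h) \<partial>lborel)"
    unfolding segment_mean_def
    by (subst nn_integral_add[symmetric])
      (auto intro!: nn_integral_cong split: split_indicator)
  also have "(\<integral>\<^sup>+t\<in>{0<..1/2}. g (x + t *\<^sub>R h) \<partial>lborel) = ennreal (1/2) * segment_mean g x (h /\<^sub>R 2)"
    unfolding segment_mean_def
    by (subst nn_integral_real_affine[where c="1/2" and t=0])
      (auto intro!: nn_integral_cong arg_cong2[where f="(*)"] split: split_indicator)
  also have "(\<integral>\<^sup>+t\<in>{1/2<..1}. g (x + t *\<^sub>R h) \<partial>lborel) =
      ennreal (1/2) * segment_mean g (x + h /\<^sub>R 2) (h /\<^sub>R 2)"
    unfolding segment_mean_def
    by (subst nn_integral_real_affine[where c="1/2" and t="1/2"])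
      (auto intro!: nn_integral_cong arg_cong2[where f="(*)"] arg_cong[where f=g]
        simp: scaleR_add_left add_ac split: split_indicator)
  finally show ?thesis
    by (simp add: divide_ennreal_def ring_distribs mult.commute)
qed

text \<open>Tonelli and translation invariance: at fixed \<open>h\<close>, averaging over translates
  preserves the total mass.\<close>

lemma nn_integral_segment_mean:
  assumes [measurable]: "g \<in> borel_measurable borel"
  shows "(\<integral>\<^sup>+x. segment_mean g x h \<partial>lborel) = (\<integral>\<^sup>+x. g x \<partial>lborel)"
proof -
  have "(\<integral>\<^sup>+x. segment_mean g x h \<partial>lborel) =
      (\<integral>\<^sup>+t. (\<integral>\<^sup>+x. g (x + t *\<^sub>R h) * indicator {0<..1} t \<partial>lborel) \<partial>lborel)"
    unfolding segment_mean_def by (intro lborel_pair.Fubini') measurable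
  also have "\<dots> = (\<integral>\<^sup>+t. (\<integral>\<^sup>+x. g x \<partial>lborel) * indicator {0<..1::real} t \<partial>lborel)"
    by (simp add: nn_integral_multc nn_integral_lborel_translate)
  finally show ?thesis by (simp add: nn_integral_cmult)
qed

text \<open>This contains the superlevel sets of the difference quotient: the factor
  \<open>norm h powr (-\<gamma>)\<close> in the bound by the mean has been moved to the
  threshold.\<close>

definition exceeds :: "('a::euclidean_space \<Rightarrow> ennreal) \<Rightarrow> real \<Rightarrow> real \<Rightarrow> 'a \<Rightarrow> 'a \<Rightarrow> bool" where
  "exceeds g \<kappa> \<gamma> x h \<longleftrightarrow> ennreal (\<kappa> * norm h powr \<gamma>) < segment_mean g x h"

lemma pred_exceeds [measurable]:
  assumes [measurable]: "g \<in> borel_measurable borel" "X \<in> borel_measurable M" "H \<in> borel_measurable M"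
  shows "Measurable.pred M (\<lambda>y. exceeds g \<kappa> \<gamma> (X y) (H y))"
  unfolding exceeds_def by measurable

text \<open>Up to the factor \<open>norm h\<close>, this sums \<open>(norm h / 2 ^ i) powr (\<gamma> + 1)\<close> over the dyadic subsegments of
  generation \<open>i < j\<close> of the segment from \<open>x\<close> to \<open>x + h\<close> on which the mean of \<open>g\<close> exceeds the threshold.\<close>

primrec bisection_sum ::
  "nat \<Rightarrow> ('a::euclidean_space \<Rightarrow> ennreal) \<Rightarrow> real \<Rightarrow> real \<Rightarrow> 'a \<Rightarrow> 'a \<Rightarrow> real" where
  "bisection_sum 0 g \<kappa> \<gamma> x h = 0"
| "bisection_sum (Suc j) g \<kappa> \<gamma> x h = of_bool (exceeds g \<kappa> \<gamma> x h) * norm h powr \<gamma> +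
     (bisection_sum j g \<kappa> \<gamma> x (h /\<^sub>R 2) + bisection_sum j g \<kappa> \<gamma> (x + h /\<^sub>R 2) (h /\<^sub>R 2)) / 2"

lemma borel_measurable_bisection_sum [measurable]:
  assumes [measurable]: "g \<in> borel_measurable borel"
    and "X \<in> borel_measurable M" "H \<in> borel_measurable M"
  shows "(\<lambda>y. bisection_sum j g \<kappa> \<gamma> (X y) (H y)) \<in> borel_measurable M"
  using assms(2,3)
proof (induction j arbitrary: X H)
  case (Suc j)
  note [measurable] = Suc.prems
  have [measurable]: "(\<lambda>y. bisection_sum j g \<kappa> \<gamma> (X y) (H y /\<^sub>R 2)) \<in> borel_measurable M"
    "(\<lambda>y. bisection_sum j g \<kappa> \<gamma> (X y + H y /\<^sub>R 2) (H y /\<^sub>R 2)) \<in> borel_measurable M"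
    by (intro Suc.IH; measurable)+
  show ?case unfolding bisection_sum.simps by measurable
qed simp

lemma bisection_sum_nonneg: "0 \<le> bisection_sum j g \<kappa> \<gamma> x h"
  by (induction j arbitrary: x h) auto

lemma norm_half_powr: "norm (h /\<^sub>R 2) powr \<gamma> = 2 powr (-\<gamma>) * norm h powr \<gamma>"
  by (simp add: powr_mult powr_minus powr_divide field_simps)

lemma ennreal_average_le:
  fixes a b c d :: real and u v :: ennreal
  assumes "ennreal a \<le> ennreal c * u" "ennreal b \<le> ennreal c * v" "0 \<le> a" "0 \<le> b" "0 \<le> c"
  shows "ennreal ((a + b) / 2) \<le> ennreal c * ((u + v) / 2)"
proof -
  have "ennreal ((a + b) / 2) = (ennreal a + ennreal b) / 2"
    using assms by (simp add: divide_ennreal flip: ennreal_plus ennreal_numeral)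
  also have "\<dots> \<le> (ennreal c * u + ennreal c * v) / 2"
    using assms by (intro divide_right_mono_ennreal add_mono)
  also have "\<dots> = ennreal c * ((u + v) / 2)"
    by (simp add: divide_ennreal_def ring_distribs mult.assoc)
  finally show ?thesis .
qed

text \<open>Even if every subsegment exceeds, the generations form a geometric series of ratio
  \<open>2 powr (-\<gamma>)\<close>, whose sum \<open>c\<close> solves
  \<open>1 + c * 2 powr (-\<gamma>) = c\<close>. This crude bound is spent only on a segment that
  exceeds, where the threshold bounds \<open>norm h powr \<gamma>\<close> by the mean; a segment
  that does not exceed passes the estimate on to its halves, whose means average to its own.\<close>

lemma bisection_sum_le_pos:
  fixes g :: "'a::euclidean_space \<Rightarrow> ennreal"
  assumes [measurable]: "g \<in> borel_measurable borel" and \<gamma>: "0 < \<gamma>" and \<kappa>: "0 < \<kappa>"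
  defines "c \<equiv> 1 / (1 - 2 powr (-\<gamma>))"
  shows "bisection_sum j g \<kappa> \<gamma> x h \<le> c * norm h powr \<gamma>"
    and "ennreal (bisection_sum j g \<kappa> \<gamma> x h) \<le> ennreal (c / \<kappa>) * segment_mean g x h"
proof -
  have q: "2 powr (-\<gamma>) < 1" using \<gamma> powr_less_mono[of "-\<gamma>" 0 "2::real"] by simp
  have c: "c > 0" "1 + c * 2 powr (-\<gamma>) = c" using q \<gamma> by (simp_all add: c_def divide_simps)
  show *: "bisection_sum j g \<kappa> \<gamma> x h \<le> c * norm h powr \<gamma>" for j x h
  proof (induction j arbitrary: x h)
    case 0
    show ?case using c by simp
  next
    case (Suc j)
    have "bisection_sum (Suc j) g \<kappa> \<gamma> x h \<le> norm h powr \<gamma> + c * norm (h /\<^sub>R 2) powr \<gamma>"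
      using Suc[of x "h /\<^sub>R 2"] Suc[of "x + h /\<^sub>R 2" "h /\<^sub>R 2"]
        powr_ge_zero[of "norm h" \<gamma>]
      by (cases "exceeds g \<kappa> \<gamma> x h") (auto simp: field_simps simp del: powr_ge_zero)
    also have "\<dots> = (1 + c * 2 powr (-\<gamma>)) * norm h powr \<gamma>"
      unfolding norm_half_powr by (simp add: algebra_simps)
    finally show ?case by (simp only: c(2))
  qed
  show "ennreal (bisection_sum j g \<kappa> \<gamma> x h) \<le> ennreal (c / \<kappa>) * segment_mean g x h"
  proof (induction j arbitrary: x h)
    case (Suc j)
    show ?case
    proof (cases "exceeds g \<kappa> \<gamma> x h")
      case True
      have "ennreal (bisection_sum (Suc j) g \<kappa> \<gamma> x h) \<le> ennreal (c / \<kappa> * (\<kappa> * norm h powr \<gamma>))"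
        using *[of "Suc j" x h] \<kappa> by (intro ennreal_leI) simp
      also have "\<dots> = ennreal (c / \<kappa>) * ennreal (\<kappa> * norm h powr \<gamma>)"
        using c \<kappa> by (intro ennreal_mult) auto
      also have "\<dots> \<le> ennreal (c / \<kappa>) * segment_mean g x h"
        using True by (intro mult_left_mono) (auto simp: exceeds_def)
      finally show ?thesis .
    next
      case False
      then show ?thesis
        using Suc[of x "h /\<^sub>R 2"] Suc[of "x + h /\<^sub>R 2" "h /\<^sub>R 2"] c \<kappa>
        by (subst segment_mean_bisect) (auto intro!: ennreal_average_le bisection_sum_nonneg)
    qed
  qed simp
qed

text \<open>Here exceeding is inherited upwards, so the exceeding segments form a subtree containing
  the root unless it is empty. Weights increase by the factor
  \<open>2 powr (-1-\<gamma>) > 1\<close> from a segment to its half, hence the last exceeding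
  segments, which do not overlap, pay for all their ancestors.\<close>

lemma bisection_sum_le_neg:
  fixes g :: "'a::euclidean_space \<Rightarrow> ennreal"
  assumes [measurable]: "g \<in> borel_measurable borel" and \<gamma>: "\<gamma> < -1" and \<kappa>: "0 < \<kappa>"
  defines "c \<equiv> 1 / (2 powr (-1-\<gamma>) - 1)"
  shows "ennreal (bisection_sum j g \<kappa> \<gamma> x h) \<le> ennreal ((1 + c) / \<kappa>) * segment_mean g x h"
proof -
  have q: "2 powr (-1-\<gamma>) > 1" using \<gamma> powr_less_mono[of 0 "-1-\<gamma>" "2::real"] by simp
  have c: "c > 0" "1 + c = c * 2 powr (-1-\<gamma>)" using q \<gamma> by (simp_all add: c_def divide_simps)
  \<comment> \<open>This identity dictates \<open>c\<close>: after the averaging factor 1/2, one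
    exceeding half contributes \<open>c * norm (h /\<^sub>R 2) powr \<gamma> / 2\<close>, which is
    exactly \<open>(1 + c) * norm h powr \<gamma>\<close>.\<close>
  have c2: "2 * (1 + c) = c * 2 powr (-\<gamma>)"
    using c(2) powr_add[of 2 "-1-\<gamma>" 1] by simp
  \<comment> \<open>The mean over a half is at most twice the mean over the whole, while the
    threshold grows by the factor \<open>2 powr (-\<gamma>)\<close>, which is at least 2. So below a
    segment that does not exceed, nothing exceeds.\<close>
  have zero: "\<not> exceeds g \<kappa> \<gamma> x h \<Longrightarrow> bisection_sum j g \<kappa> \<gamma> x h = 0" for j x h
  proof (induction j arbitrary: x h)
    case (Suc j)
    let ?a = "segment_mean g x (h /\<^sub>R 2)" and ?b = "segment_mean g (x + h /\<^sub>R 2) (h /\<^sub>R 2)"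
    have "(?a + ?b) / 2 \<le> ennreal (\<kappa> * norm h powr \<gamma>)"
      using Suc.prems segment_mean_bisect[of g x h] by (simp add: exceeds_def not_less)
    then have "2 * ((?a + ?b) / 2) \<le> 2 * ennreal (\<kappa> * norm h powr \<gamma>)"
      by (intro mult_left_mono) auto
    moreover have "2 * (u / 2) = u" for u :: ennreal
      by (simp add: ennreal_times_divide mult_divide_eq_ennreal mult.commute)
    ultimately have "?a + ?b \<le> 2 * ennreal (\<kappa> * norm h powr \<gamma>)" by (simp only:)
    also have "2 * ennreal (\<kappa> * norm h powr \<gamma>) = ennreal (2 * (\<kappa> * norm h powr \<gamma>))"
      using \<kappa> by (subst ennreal_mult) auto
    also have "ennreal (2 * (\<kappa> * norm h powr \<gamma>)) \<le> ennreal (\<kappa> * norm (h /\<^sub>R 2) powr \<gamma>)"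
    proof (intro ennreal_leI)
      have "2 \<le> 2 powr (-\<gamma>)" using \<gamma> powr_mono[of 1 "-\<gamma>" "2::real"] by simp
      then show "2 * (\<kappa> * norm h powr \<gamma>) \<le> \<kappa> * norm (h /\<^sub>R 2) powr \<gamma>"
        unfolding norm_half_powr using \<kappa> by (simp add: mult.left_commute mult_right_mono)
    qed
    finally have "?a + ?b \<le> ennreal (\<kappa> * norm (h /\<^sub>R 2) powr \<gamma>)" .
    then have "\<not> exceeds g \<kappa> \<gamma> x (h /\<^sub>R 2)" "\<not> exceeds g \<kappa> \<gamma> (x + h /\<^sub>R 2) (h /\<^sub>R 2)"
      unfolding exceeds_def not_less
      by (auto intro: order_trans add_increasing add_increasing2 elim: order_trans[rotated])
    then show ?case using Suc by simp
  qed simp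
  \<comment> \<open>The summand with \<open>c\<close> makes the induction go through: halving an exceeding segment gains
      enough from an exceeding half to pay for the segment itself.\<close>
  have "ennreal (bisection_sum j g \<kappa> \<gamma> x h + c * (of_bool (exceeds g \<kappa> \<gamma> x h) * norm h powr \<gamma>))
      \<le> ennreal ((1 + c) / \<kappa>) * segment_mean g x h" (is "?L j x h \<le> ?R x h") for j x h
  proof (cases "exceeds g \<kappa> \<gamma> x h")
    case True
    have base: "ennreal ((1 + c) * norm h powr \<gamma>) \<le> ?R x h" if "exceeds g \<kappa> \<gamma> x h" for x h
    proof -
      have "ennreal ((1 + c) * norm h powr \<gamma>) = ennreal ((1 + c) / \<kappa> * (\<kappa> * norm h powr \<gamma>))"
        using \<kappa> by simp
      also have "\<dots> = ennreal ((1 + c) / \<kappa>) * ennreal (\<kappa> * norm h powr \<gamma>)"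
        using c(1) \<kappa> by (intro ennreal_mult) auto
      also have "\<dots> \<le> ?R x h"
        using that by (intro mult_left_mono) (auto simp: exceeds_def)
      finally show ?thesis .
    qed
    show ?thesis using True
    proof (induction j arbitrary: x h)
      case 0
      have "ennreal (c * norm h powr \<gamma>) \<le> ennreal ((1 + c) * norm h powr \<gamma>)"
        by (intro ennreal_leI mult_right_mono) auto
      also have "\<dots> \<le> ?R x h" by (rule base[OF 0])
      finally show ?case using 0 by simp
    next
      case (Suc j)
      let ?h = "h /\<^sub>R 2" and ?y = "x + h /\<^sub>R 2"
      let ?A = "bisection_sum j g \<kappa> \<gamma> x ?h + c * (of_bool (exceeds g \<kappa> \<gamma> x ?h) * norm ?h powr \<gamma>)"
      let ?B = "bisection_sum j g \<kappa> \<gamma> ?y ?h + c * (of_bool (exceeds g \<kappa> \<gamma> ?y ?h) * norm ?h powr \<gamma>)"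
      show ?case
      proof (cases "exceeds g \<kappa> \<gamma> x ?h \<or> exceeds g \<kappa> \<gamma> ?y ?h")
        case True
        have "(1 + c) * norm h powr \<gamma> = c * norm ?h powr \<gamma> / 2"
          unfolding norm_half_powr using arg_cong[OF c2, of "\<lambda>a. a * norm h powr \<gamma> / 2"] by (simp add: algebra_simps)
        moreover have "bisection_sum (Suc j) g \<kappa> \<gamma> x h + c * norm h powr \<gamma> =
            (1 + c) * norm h powr \<gamma> + (bisection_sum j g \<kappa> \<gamma> x ?h + bisection_sum j g \<kappa> \<gamma> ?y ?h) / 2"
          using Suc.prems by (simp add: algebra_simps)
        moreover have "0 \<le> c * norm ?h powr \<gamma>" using c by simp
        ultimately have "bisection_sum (Suc j) g \<kappa> \<gamma> x h + c * norm h powr \<gamma> \<le> (?A + ?B) / 2"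
          using True by (auto simp: of_bool_def simp del: bisection_sum.simps norm_scaleR)
        then have "?L (Suc j) x h \<le> ennreal ((?A + ?B) / 2)"
          using Suc.prems by (intro ennreal_leI) (simp del: bisection_sum.simps norm_scaleR)
        also have "\<dots> \<le> ennreal ((1 + c) / \<kappa>) * ((segment_mean g x ?h + segment_mean g ?y ?h) / 2)"
        proof (rule ennreal_average_le)
          show "ennreal ?A \<le> ?R x ?h"
            using Suc.IH[of x ?h] zero[of x ?h j] by (cases "exceeds g \<kappa> \<gamma> x ?h") auto
          show "ennreal ?B \<le> ?R ?y ?h"
            using Suc.IH[of ?y ?h] zero[of ?y ?h j] by (cases "exceeds g \<kappa> \<gamma> ?y ?h") auto
        qed (use c \<kappa> in \<open>auto intro!: add_nonneg_nonneg bisection_sum_nonneg\<close>)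
        finally show ?thesis by (subst segment_mean_bisect) auto
      next
        \<comment> \<open>A last exceeding segment: the sum reduces to its own term, and only here
          is its mean spent directly.\<close>
        case False
        then show ?thesis
          using base[OF Suc.prems] Suc.prems by (simp add: zero algebra_simps)
      qed
    qed
  qed (simp add: zero)
  then show ?thesis
    by (rule order_trans[rotated]) (use c in \<open>auto intro!: ennreal_leI\<close>)
qed

lemma bisection_sum_le:
  assumes "0 < \<gamma> \<or> \<gamma> < -1"
  shows "\<exists>c>0. \<forall>(g :: 'a::euclidean_space \<Rightarrow> ennreal) \<kappa> j x h. g \<in> borel_measurable borel \<longrightarrow> 0 < \<kappa> \<longrightarrow>
    ennreal (bisection_sum j g \<kappa> \<gamma> x h) \<le> ennreal (c / \<kappa>) * segment_mean g x h"
  using assms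
proof
  assume \<gamma>: "0 < \<gamma>"
  moreover have "1 / (1 - 2 powr (-\<gamma>)) > 0" using powr_less_mono[of "-\<gamma>" 0 "2::real"] \<gamma> by simp
  ultimately show ?thesis using bisection_sum_le_pos(2) by blast
next
  assume \<gamma>: "\<gamma> < -1"
  moreover have "1 + 1 / (2 powr (-1-\<gamma>) - 1) > 0"
    using powr_less_mono[of 0 "-1-\<gamma>" "2::real"] \<gamma> by (simp add: add_pos_pos)
  ultimately show ?thesis using bisection_sum_le_neg by blast
qed

definition exceed_mass :: "('a::euclidean_space \<Rightarrow> ennreal) \<Rightarrow> real \<Rightarrow> real \<Rightarrow> 'a \<Rightarrow> ennreal" where
  "exceed_mass g \<kappa> \<gamma> h = (\<integral>\<^sup>+x. ennreal (of_bool (exceeds g \<kappa> \<gamma> x h) * norm h powr \<gamma>) \<partial>lborel)"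

lemma borel_measurable_exceed_mass [measurable]:
  assumes [measurable]: "g \<in> borel_measurable borel" "H \<in> borel_measurable M"
  shows "(\<lambda>y. exceed_mass g \<kappa> \<gamma> (H y)) \<in> borel_measurable M"
  unfolding exceed_mass_def of_bool_def by measurable

text \<open>After integration in \<open>x\<close> the two halves contribute equally by translation
  invariance, which cancels the factor 1/2 of the recursion. Generation \<open>i\<close> thus
  becomes scale \<open>h /\<^sub>R 2 ^ i\<close>, with no loss.\<close>

lemma nn_integral_bisection_sum:
  assumes [measurable]: "g \<in> borel_measurable borel"
  shows "(\<integral>\<^sup>+x. ennreal (bisection_sum j g \<kappa> \<gamma> x h) \<partial>lborel) = (\<Sum>i<j. exceed_mass g \<kappa> \<gamma> (h /\<^sub>R 2 ^ i))"
proof (induction j arbitrary: h)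
  case (Suc j)
  let ?h = "h /\<^sub>R 2"
  have split: "ennreal (p + (a + b) / 2) = ennreal p + ennreal (1/2) * (ennreal a + ennreal b)"
    if "0 \<le> p" "0 \<le> a" "0 \<le> b" for p a b :: real
  proof -
    have "ennreal (p + (a + b) / 2) = ennreal (p + 1/2 * (a + b))" by simp
    also have "\<dots> = ennreal p + ennreal (1/2) * (ennreal a + ennreal b)"
      using that by (subst ennreal_plus, simp, simp, subst ennreal_mult) (auto simp: ennreal_plus)
    finally show ?thesis .
  qed
  have half: "ennreal (1/2) * 2 = 1"
  proof -
    have "ennreal (1/2) * 2 = ennreal (1/2) * ennreal 2" by (simp only: ennreal_numeral)
    also have "\<dots> = ennreal (1/2 * 2)" by (rule ennreal_mult[symmetric]) auto
    finally show ?thesis by simp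
  qed
  have "(\<integral>\<^sup>+x. ennreal (bisection_sum (Suc j) g \<kappa> \<gamma> x h) \<partial>lborel) =
     (\<integral>\<^sup>+x. ennreal (of_bool (exceeds g \<kappa> \<gamma> x h) * norm h powr \<gamma>) + ennreal (1/2) *
       (ennreal (bisection_sum j g \<kappa> \<gamma> x ?h) + ennreal (bisection_sum j g \<kappa> \<gamma> (x + ?h) ?h)) \<partial>lborel)"
    by (intro nn_integral_cong) (simp only: bisection_sum.simps, rule split,
        auto intro!: bisection_sum_nonneg)
  also have "\<dots> = exceed_mass g \<kappa> \<gamma> h + ennreal (1/2) *
      ((\<integral>\<^sup>+x. ennreal (bisection_sum j g \<kappa> \<gamma> x ?h) \<partial>lborel) +
       (\<integral>\<^sup>+x. ennreal (bisection_sum j g \<kappa> \<gamma> (x + ?h) ?h) \<partial>lborel))"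
    unfolding exceed_mass_def by (simp add: nn_integral_add nn_integral_cmult of_bool_def)
  also have "(\<integral>\<^sup>+x. ennreal (bisection_sum j g \<kappa> \<gamma> (x + ?h) ?h) \<partial>lborel) =
      (\<integral>\<^sup>+x. ennreal (bisection_sum j g \<kappa> \<gamma> x ?h) \<partial>lborel)"
    by (rule nn_integral_lborel_translate[where F="\<lambda>x. ennreal (bisection_sum j g \<kappa> \<gamma> x ?h)"]) simp
  also have "ennreal (1/2) * ((\<integral>\<^sup>+x. ennreal (bisection_sum j g \<kappa> \<gamma> x ?h) \<partial>lborel) +
      (\<integral>\<^sup>+x. ennreal (bisection_sum j g \<kappa> \<gamma> x ?h) \<partial>lborel)) =
      (\<integral>\<^sup>+x. ennreal (bisection_sum j g \<kappa> \<gamma> x ?h) \<partial>lborel)"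
    unfolding mult_2[symmetric] mult.assoc[symmetric] half by simp
  also have "\<dots> = (\<Sum>i<j. exceed_mass g \<kappa> \<gamma> (h /\<^sub>R 2 ^ Suc i))"
    by (simp add: Suc.IH)
  finally show ?case unfolding sum.lessThan_Suc_shift by simp
qed simp

text \<open>The measure \<open>norm h powr (-n) dh\<close> is invariant under dilations, so the
  bound depends on the ratio \<open>s\<close> of the radii but not on \<open>r\<close>.\<close>

lemma nn_integral_annulus_powr_le:
  fixes r s :: real
  assumes "0 < r" "0 < s"
  shows "(\<integral>\<^sup>+(h::'a::euclidean_space). ennreal (if r < norm h \<and> norm h \<le> s * r then norm h powr (- real DIM('a)) else 0) \<partial>lborel)
    \<le> ennreal (s ^ DIM('a) * unit_ball_vol (real DIM('a)))"
proof -
  have "(\<integral>\<^sup>+(h::'a). ennreal (if r < norm h \<and> norm h \<le> s * r then norm h powr (- real DIM('a)) else 0) \<partial>lborel)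
     \<le> (\<integral>\<^sup>+(h::'a). ennreal (r powr (- real DIM('a))) * indicator (cball 0 (s * r)) h \<partial>lborel)"
    using assms by (intro nn_integral_mono) (auto simp: indicator_def intro!: ennreal_leI powr_mono2')
  also have "\<dots> = ennreal (r powr (- real DIM('a))) * ennreal (unit_ball_vol (real DIM('a)) * (s * r) ^ DIM('a))"
    using assms by (subst nn_integral_cmult_indicator) (auto simp: emeasure_cball)
  also have "\<dots> = ennreal (s ^ DIM('a) * unit_ball_vol (real DIM('a)))"
    using assms by (simp add: powr_minus powr_realpow power_mult_distrib ennreal_mult[symmetric] field_simps)
  finally show ?thesis .
qed

text \<open>Dilation by \<open>2 ^ i\<close> carries the i-th dyadic annulus to the outermost one
  and preserves \<open>norm h powr (-n) dh\<close>. An integral over many scales becomes a sum over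
  generations on a single annulus, the form in which bisection sums apply.\<close>

lemma nn_integral_annuli:
  fixes a :: "'a::euclidean_space \<Rightarrow> ennreal"
  assumes [measurable]: "a \<in> borel_measurable borel" and R: "0 < R"
  defines "A \<equiv> \<lambda>r s (h::'a). ennreal (if r < norm h \<and> norm h \<le> s then norm h powr (- real DIM('a)) else 0)"
  shows "(\<integral>\<^sup>+h. A (R / 2 ^ j) R h * a h \<partial>lborel) =
    (\<integral>\<^sup>+h. A (R / 2) R h * (\<Sum>i<j. a (h /\<^sub>R 2 ^ i)) \<partial>lborel)"
proof -
  have [measurable]: "A r s \<in> borel_measurable borel" for r s unfolding A_def by measurable
  have step: "(\<integral>\<^sup>+h. A (R / 2 ^ Suc j) (R / 2 ^ j) h * a h \<partial>lborel) =
      (\<integral>\<^sup>+h. A (R / 2) R h * a (h /\<^sub>R 2 ^ j) \<partial>lborel)" for j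
  proof -
    have "ennreal (inverse (2 ^ j) ^ DIM('a)) * A (R / 2 ^ Suc j) (R / 2 ^ j) (h /\<^sub>R 2 ^ j) = A (R / 2) R h" for h
    proof -
      have "inverse (2 ^ j) ^ DIM('a) * norm (h /\<^sub>R 2 ^ j) powr (- real DIM('a)) = norm h powr (- real DIM('a))"
        by (simp add: powr_mult powr_minus powr_divide powr_realpow power_inverse divide_simps)
      moreover have "R / 2 ^ Suc j < norm (h /\<^sub>R 2 ^ j) \<longleftrightarrow> R / 2 < norm h"
        "norm (h /\<^sub>R 2 ^ j) \<le> R / 2 ^ j \<longleftrightarrow> norm h \<le> R"
        by (simp_all add: field_simps)
      ultimately show ?thesis
        unfolding A_def by (auto simp del: norm_scaleR simp flip: ennreal_mult)
    qed
    then show ?thesis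
      by (subst nn_integral_lborel_scaleR[where c="inverse (2 ^ j)"])
        (simp_all add: mult.assoc[symmetric] flip: nn_integral_cmult)
  qed
  show ?thesis
  proof (induction j)
    case 0
    have "A R R h = 0" for h by (auto simp: A_def)
    then show ?case by simp
  next
    case (Suc j)
    have "A (R / 2 ^ Suc j) R h = A (R / 2 ^ j) R h + A (R / 2 ^ Suc j) (R / 2 ^ j) h" for h
    proof -
      have "R / 2 ^ Suc j < R / 2 ^ j" "R / 2 ^ j \<le> R" using R by (auto simp: field_simps)
      then show ?thesis by (auto simp: A_def)
    qed
    then show ?case
      using Suc.IH step[of j] by (simp add: distrib_left distrib_right nn_integral_add)
  qed
qed

text \<open>The weight is \<open>norm h powr \<gamma>\<close>, which belongs to the bisection sum,
  times the dilation invariant \<open>norm h powr (-n)\<close>. On one annulus the bisection sum is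
  dominated by the segment mean at each \<open>h\<close>; the result depends neither on the outer
  radius nor on the number of annuli, so both can be exhausted.\<close>

lemma weak_type_exceeds:
  assumes "0 < \<gamma> \<or> \<gamma> < -1"
  shows "\<exists>C>0. \<forall>(g :: 'a::euclidean_space \<Rightarrow> ennreal) \<kappa>. g \<in> borel_measurable borel \<longrightarrow> 0 < \<kappa> \<longrightarrow>
    (\<integral>\<^sup>+h. \<integral>\<^sup>+x. ennreal (of_bool (exceeds g \<kappa> \<gamma> x h) * norm h powr (\<gamma> - real DIM('a))) \<partial>lborel \<partial>lborel)
      \<le> ennreal (C / \<kappa>) * (\<integral>\<^sup>+x. g x \<partial>lborel)"
proof -
  obtain c where c: "c > 0" and bound: "\<And>(g :: 'a \<Rightarrow> ennreal) \<kappa> j x h. g \<in> borel_measurable borel \<Longrightarrow> 0 < \<kappa> \<Longrightarrow>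
    ennreal (bisection_sum j g \<kappa> \<gamma> x h) \<le> ennreal (c / \<kappa>) * segment_mean g x h"
    using bisection_sum_le[OF assms] by blast
  define B where "B = 2 ^ DIM('a) * unit_ball_vol (real DIM('a))"
  have B: "B > 0" by (simp add: B_def)
  have "(\<integral>\<^sup>+h. \<integral>\<^sup>+x. ennreal (of_bool (exceeds g \<kappa> \<gamma> x h) * norm h powr (\<gamma> - real DIM('a))) \<partial>lborel \<partial>lborel)
      \<le> ennreal (B * c / \<kappa>) * (\<integral>\<^sup>+x. g x \<partial>lborel)" (is "?I \<le> ?N")
    if [measurable]: "g \<in> borel_measurable borel" and \<kappa>: "0 < \<kappa>" for g :: "'a \<Rightarrow> ennreal" and \<kappa>
  proof -
    define A where "A r s h = ennreal (if r < norm h \<and> norm h \<le> s then norm h powr (- real DIM('a)) else 0)"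
      for r s and h :: 'a
    have [measurable]: "A r s \<in> borel_measurable borel" for r s unfolding A_def by measurable
    have annuli: "(\<integral>\<^sup>+h. A (R / 2 ^ j) R h * exceed_mass g \<kappa> \<gamma> h \<partial>lborel) \<le> ?N" if R: "0 < R" for R j
    proof -
      have "(\<integral>\<^sup>+h. A (R / 2 ^ j) R h * exceed_mass g \<kappa> \<gamma> h \<partial>lborel) =
          (\<integral>\<^sup>+h. A (R / 2) R h * (\<integral>\<^sup>+x. ennreal (bisection_sum j g \<kappa> \<gamma> x h) \<partial>lborel) \<partial>lborel)"
        unfolding A_def by (simp add: nn_integral_annuli R nn_integral_bisection_sum)
      also have "\<dots> \<le> (\<integral>\<^sup>+h. A (R / 2) R h * (ennreal (c / \<kappa>) * (\<integral>\<^sup>+x. g x \<partial>lborel)) \<partial>lborel)"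
      proof (intro nn_integral_mono mult_left_mono)
        fix h
        have "(\<integral>\<^sup>+x. ennreal (bisection_sum j g \<kappa> \<gamma> x h) \<partial>lborel) \<le>
            (\<integral>\<^sup>+x. ennreal (c / \<kappa>) * segment_mean g x h \<partial>lborel)"
          using \<kappa> by (intro nn_integral_mono bound) auto
        then show "(\<integral>\<^sup>+x. ennreal (bisection_sum j g \<kappa> \<gamma> x h) \<partial>lborel) \<le>
            ennreal (c / \<kappa>) * (\<integral>\<^sup>+x. g x \<partial>lborel)"
          by (simp add: nn_integral_cmult nn_integral_segment_mean)
      qed simp
      also have "\<dots> = (\<integral>\<^sup>+h. A (R / 2) R h \<partial>lborel) * (ennreal (c / \<kappa>) * (\<integral>\<^sup>+x. g x \<partial>lborel))"
        by (simp add: nn_integral_multc)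
      also have "\<dots> \<le> ennreal B * (ennreal (c / \<kappa>) * (\<integral>\<^sup>+x. g x \<partial>lborel))"
        using nn_integral_annulus_powr_le[of "R / 2" 2, where 'a='a] R
        by (intro mult_right_mono) (auto simp: A_def B_def)
      also have "\<dots> = ?N"
        using B c \<kappa> by (simp add: mult.assoc[symmetric] flip: ennreal_mult)
      finally show ?thesis .
    qed
    \<comment> \<open>These are the annuli from \<open>2 ^ (-j)\<close> to \<open>2 ^ j\<close>,
      written as \<open>2 * j\<close> dyadic annuli below \<open>R = 2 ^ j\<close>. They exhaust all
      \<open>h\<close> except 0, where the weight is 0 because \<open>0 powr r = 0\<close>.\<close>
    define F where "F j h = A (2 ^ j / 2 ^ (2 * j)) (2 ^ j) h * exceed_mass g \<kappa> \<gamma> h" for j :: nat and h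
    have mono: "incseq F"
      unfolding F_def A_def
    proof (intro incseq_SucI le_funI mult_right_mono ennreal_leI)
      fix j :: nat and h :: 'a
      have widen: "(if l < n \<and> n \<le> u then v else 0) \<le> (if l' < n \<and> n \<le> u' then v else 0)"
        if "l' \<le> l" "u \<le> u'" "0 \<le> v" for l l' u u' n v :: real
        using that by auto
      show "(if 2 ^ j / 2 ^ (2 * j) < norm h \<and> norm h \<le> 2 ^ j then norm h powr (- real DIM('a)) else 0) \<le>
        (if 2 ^ Suc j / 2 ^ (2 * Suc j) < norm h \<and> norm h \<le> 2 ^ Suc j then norm h powr (- real DIM('a)) else 0)"
        by (rule widen) (auto simp: field_simps)
    qed auto
    have "?I = (\<integral>\<^sup>+h. ennreal (norm h powr (- real DIM('a))) * exceed_mass g \<kappa> \<gamma> h \<partial>lborel)"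
      unfolding exceed_mass_def
      by (intro nn_integral_cong, subst nn_integral_cmult[symmetric])
        (auto simp: powr_diff powr_minus divide_inverse mult_ac of_bool_def intro!: nn_integral_cong simp flip: ennreal_mult)
    also have "\<dots> \<le> (\<integral>\<^sup>+h. (SUP j. F j h) \<partial>lborel)"
    proof (intro nn_integral_mono)
      fix h :: 'a
      show "ennreal (norm h powr (- real DIM('a))) * exceed_mass g \<kappa> \<gamma> h \<le> (SUP j. F j h)"
      proof (cases "h = 0")
        case False
        obtain j1 where j1: "norm h < 2 ^ j1" using real_arch_pow[of 2 "norm h"] by auto
        obtain j2 where j2: "1 / norm h < 2 ^ j2" using real_arch_pow[of 2 "1 / norm h"] by auto
        define j where "j = max j1 j2"
        have "norm h \<le> 2 ^ j" by (rule order_trans[OF less_imp_le[OF j1]]) (simp add: j_def)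
        moreover have "1 / norm h < 2 ^ j" by (rule less_le_trans[OF j2]) (simp add: j_def)
        then have "2 ^ j / 2 ^ (2 * j) < norm h" using False
          unfolding mult_2 power_add by (simp add: field_simps)
        ultimately have "F j h = ennreal (norm h powr (- real DIM('a))) * exceed_mass g \<kappa> \<gamma> h"
          by (simp add: F_def A_def)
        then show ?thesis by (metis SUP_upper UNIV_I)
      qed simp
    qed
    also have "\<dots> = (SUP j. \<integral>\<^sup>+h. F j h \<partial>lborel)"
      by (intro nn_integral_monotone_convergence_SUP mono) (simp add: F_def)
    also have "\<dots> \<le> ?N"
      unfolding F_def by (intro SUP_least annuli) simp
    finally show ?thesis .
  qed
  then show ?thesis using B c by (intro exI[of _ "B * c"]) simp
qed

section \<open>Smooth bump functions and the fundamental lemma\<close>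

lemma partial_derivative_eq:
  "(\<phi> has_derivative D) (at x) \<Longrightarrow> partial_derivative i \<phi> x = D (axis i 1)"
  unfolding partial_derivative_def by (simp flip: frechet_derivative_at)

lemma partial_derivative_mult:
  assumes "\<And>x. f differentiable (at x)" "\<And>x. g differentiable (at x)"
  shows "partial_derivative i (\<lambda>x. f x * g x) =
    (\<lambda>x. f x * partial_derivative i g x + partial_derivative i f x * g x)"
proof
  fix x
  have "((\<lambda>x. f x * g x) has_derivative
      (\<lambda>h. f x * frechet_derivative g (at x) h + frechet_derivative f (at x) h * g x)) (at x)"
    using assms by (intro has_derivative_mult) (auto simp flip: frechet_derivative_works)
  then show "partial_derivative i (\<lambda>x. f x * g x) x =
      f x * partial_derivative i g x + partial_derivative i f x * g x"
    by (simp add: partial_derivative_eq) (simp add: partial_derivative_def)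
qed

lemma partial_derivative_add:
  assumes "\<And>x. f differentiable (at x)" "\<And>x. g differentiable (at x)"
  shows "partial_derivative i (\<lambda>x. f x + g x) =
    (\<lambda>x. partial_derivative i f x + partial_derivative i g x)"
proof
  fix x
  have "((\<lambda>x. f x + g x) has_derivative
      (\<lambda>h. frechet_derivative f (at x) h + frechet_derivative g (at x) h)) (at x)"
    using assms by (intro has_derivative_add) (auto simp flip: frechet_derivative_works)
  then show "partial_derivative i (\<lambda>x. f x + g x) x =
      partial_derivative i f x + partial_derivative i g x"
    by (simp add: partial_derivative_eq) (simp add: partial_derivative_def)
qed

lemma C_k_SucD: "C_k (Suc k) \<phi> \<Longrightarrow> C_k k \<phi>"
proof (induction k arbitrary: \<phi>)
  case 0
  then show ?case
    by (auto intro!: differentiable_imp_continuous_on simp: differentiable_on_def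
        intro: differentiable_at_withinI)
qed auto

lemma C_k_add: "C_k k f \<Longrightarrow> C_k k g \<Longrightarrow> C_k k (\<lambda>x. f x + g x)"
  by (induction k arbitrary: f g) (auto intro: continuous_intros simp: partial_derivative_add)

lemma C_k_mult: "C_k k f \<Longrightarrow> C_k k g \<Longrightarrow> C_k k (\<lambda>x. f x * g x)"
proof (induction k arbitrary: f g)
  case (Suc k)
  then have "C_k k f" "C_k k g" by (auto intro: C_k_SucD)
  then show ?case
    using Suc by (auto simp: partial_derivative_mult intro!: C_k_add Suc.IH)
qed (auto intro: continuous_intros)

lemma C_k_const: "C_k k (\<lambda>x. c)"
proof (induction k arbitrary: c)
  case (Suc k)
  then show ?case by (simp add: partial_derivative_def[abs_def])
qed simp

lemma C_k_prod:
  assumes "finite I" "\<And>i. i \<in> I \<Longrightarrow> C_k k (f i)"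
  shows "C_k k (\<lambda>x. \<Prod>i\<in>I. f i x)"
  using assms by (induction I rule: finite_induct) (auto intro!: C_k_mult C_k_const)

text \<open>A whole sequence of successive derivatives and a free factor \<open>r\<close> make the
  family closed under partial derivatives: each one shifts \<open>j\<close> and multiplies
  \<open>r\<close> by \<open>c\<close> or by 0.\<close>

lemma C_k_compose_coordinate:
  fixes \<psi> :: "nat \<Rightarrow> real \<Rightarrow> real"
  assumes \<psi>: "\<And>j t. (\<psi> j has_real_derivative \<psi> (Suc j) t) (at t)"
  shows "C_k k (\<lambda>x::real^'n. r * \<psi> j (a + c * x $ m))"
proof (induction k arbitrary: r j)
  have D: "((\<lambda>x::real^'n. r * \<psi> j (a + c * x $ m)) has_derivative
      (\<lambda>h. r * (\<psi> (Suc j) (a + c * x $ m) * (c * h $ m)))) (at x)" for r j x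
  proof (intro has_derivative_mult_right)
    have "((\<lambda>x::real^'n. a + c * x $ m) has_derivative (\<lambda>h. c * h $ m)) (at x)"
      by (auto intro!: derivative_eq_intros bounded_linear_imp_has_derivative bounded_linear_vec_nth)
    then show "((\<lambda>x::real^'n. \<psi> j (a + c * x $ m)) has_derivative
        (\<lambda>h. \<psi> (Suc j) (a + c * x $ m) * (c * h $ m))) (at x)"
      by (rule has_derivative_compose) (rule \<psi>[unfolded has_field_derivative_def])
  qed
  {
    case 0
    show ?case
      unfolding C_k.simps by (rule has_derivative_continuous_on, rule has_derivative_at_withinI, rule D)
  next
    case (Suc k)
    have pd: "partial_derivative i (\<lambda>x::real^'n. r * \<psi> j (a + c * x $ m)) =
      (\<lambda>x. (r * c * axis i 1 $ m) * \<psi> (Suc j) (a + c * x $ m))" for i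
      by (rule ext) (simp add: partial_derivative_eq[OF D])
    have "(\<lambda>x::real^'n. r * \<psi> j (a + c * x $ m)) differentiable (at x)" for x
      unfolding differentiable_def by (rule exI, rule D)
    then show ?case
      unfolding C_k.simps pd using Suc by blast
  }
qed

text \<open>The classical flat function \<open>exp (- c / t)\<close>, with a polynomial in
  \<open>1 / t\<close> so that the family is closed under differentiation. The free \<open>c\<close>
  controls steepness: as \<open>c\<close> tends to 0, \<open>flat c 1\<close> tends to 1 on the
  positive axis.\<close>

definition flat :: "real \<Rightarrow> real poly \<Rightarrow> real \<Rightarrow> real" where
  "flat c P t = (if 0 < t then poly P (1 / t) * exp (- c / t) else 0)"

lemma tendsto_poly_times_exp:
  fixes P :: "real poly"
  assumes c: "0 < c"
  shows "((\<lambda>y. poly P y * exp (- (c * y))) \<longlongrightarrow> 0) at_top"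
proof -
  have lim: "((\<lambda>y. y ^ i * exp (- (c * y))) \<longlongrightarrow> 0) at_top" for i
  proof -
    have "((\<lambda>y. (1 / c ^ i) * ((c * y) ^ i / exp (c * y))) \<longlongrightarrow> (1 / c ^ i) * 0) at_top"
      using c by (intro tendsto_mult tendsto_const filterlim_compose[OF tendsto_power_div_exp_0]
          filterlim_tendsto_pos_mult_at_top[OF tendsto_const] filterlim_ident)
    then show ?thesis using c by (simp add: power_mult_distrib exp_minus field_simps)
  qed
  have "((\<lambda>y. \<Sum>i\<le>degree P. coeff P i * (y ^ i * exp (- (c * y)))) \<longlongrightarrow> (\<Sum>i\<le>degree P. coeff P i * 0)) at_top"
    by (intro tendsto_sum tendsto_mult tendsto_const lim)
  then show ?thesis by (simp add: poly_altdef sum_distrib_right mult.assoc)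
qed

text \<open>In the variable \<open>s = 1 / t\<close>, differentiation in \<open>t\<close> is
  \<open>- s\<^sup>2\<close> times differentiation in \<open>s\<close>, which sends \<open>P\<close>
  to \<open>s\<^sup>2 * (c * P - P')\<close>; the factor \<open>[:0, 0, 1:]\<close> is
  \<open>s\<^sup>2\<close>.\<close>

lemma flat_has_derivative:
  assumes c: "0 < c"
  shows "(flat c P has_real_derivative flat c ([:0, 0, 1:] * (smult c P - pderiv P)) t) (at t)"
proof -
  consider "t > 0" | "t < 0" | "t = 0" by linarith
  then show ?thesis
  proof cases
    case 1
    have "((\<lambda>t. 1 / t) has_real_derivative - (1 / t)\<^sup>2) (at t)"
      using 1 by (auto intro!: derivative_eq_intros simp: power2_eq_square)
    then have "((\<lambda>t. poly P (1 / t)) has_real_derivative poly (pderiv P) (1 / t) * - (1 / t)\<^sup>2) (at t)"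
      by (rule DERIV_chain2[OF poly_DERIV])
    moreover have "((\<lambda>t. exp (- c / t)) has_real_derivative exp (- c / t) * (c * (1 / t)\<^sup>2)) (at t)"
      using 1 by (auto intro!: derivative_eq_intros simp: power2_eq_square)
    ultimately have "((\<lambda>t. poly P (1 / t) * exp (- c / t)) has_real_derivative
        poly (pderiv P) (1 / t) * - (1 / t)\<^sup>2 * exp (- c / t) +
        exp (- c / t) * (c * (1 / t)\<^sup>2) * poly P (1 / t)) (at t)"
      by (rule DERIV_mult)
    also have "poly (pderiv P) (1 / t) * - (1 / t)\<^sup>2 * exp (- c / t) +
        exp (- c / t) * (c * (1 / t)\<^sup>2) * poly P (1 / t) =
        flat c ([:0, 0, 1:] * (smult c P - pderiv P)) t"
      using 1 unfolding flat_def by (simp add: power2_eq_square ring_distribs)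
    finally show ?thesis
      by (rule has_field_derivative_transform_within_open[where S="{0<..}"])
        (use 1 in \<open>auto simp: flat_def\<close>)
  next
    case 2
    have "((\<lambda>t. 0) has_real_derivative flat c ([:0, 0, 1:] * (smult c P - pderiv P)) t) (at t)"
      using 2 by (simp add: flat_def)
    then show ?thesis
      by (rule has_field_derivative_transform_within_open[where S="{..<0}"])
        (use 2 in \<open>auto simp: flat_def\<close>)
  next
    case 3
    \<comment> \<open>At 0 the difference quotient from the right is the function itself times
      \<open>1 / h\<close>, that is, \<open>P\<close> multiplied by one more power of its
      variable.\<close>
    have "((\<lambda>h. poly (pCons 0 P) (inverse h) * exp (- (c * inverse h))) \<longlongrightarrow> 0) (at_right 0)"
      using filterlim_compose[OF tendsto_poly_times_exp[OF c] filterlim_inverse_at_top_right] .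
    then have "((\<lambda>h. (flat c P (0 + h) - flat c P 0) / h) \<longlongrightarrow> 0) (at_right 0)"
      by (rule Lim_transform_eventually)
        (auto simp: flat_def eventually_at_filter divide_inverse)
    moreover have "((\<lambda>h. (flat c P (0 + h) - flat c P 0) / h) \<longlongrightarrow> 0) (at_left 0)"
      by (rule Lim_transform_eventually[OF tendsto_const])
        (auto simp: flat_def eventually_at_filter)
    ultimately show ?thesis
      unfolding 3 DERIV_def by (simp add: flat_def filterlim_split_at)
  qed
qed

definition box_bump :: "real \<Rightarrow> real^'n \<Rightarrow> real^'n \<Rightarrow> real^'n \<Rightarrow> real" where
  "box_bump c a b x = (\<Prod>i\<in>UNIV. flat c 1 (x $ i - a $ i) * flat c 1 (b $ i - x $ i))"

lemma box_bump_bounds: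
  assumes "0 < c"
  shows "0 \<le> box_bump c a b x" "box_bump c a b x \<le> indicator (box a b) x"
proof -
  have f: "0 \<le> flat c 1 t" "flat c 1 t \<le> 1" for t
    using assms by (auto simp: flat_def)
  show "0 \<le> box_bump c a b x"
    unfolding box_bump_def using f by (intro prod_nonneg) auto
  show "box_bump c a b x \<le> indicator (box a b) x"
  proof (cases "x \<in> box a b")
    case True
    then show ?thesis
      unfolding box_bump_def using f by (auto intro!: prod_le_1 mult_le_one)
  next
    case False
    then obtain i where "x $ i \<le> a $ i \<or> b $ i \<le> x $ i"
      by (auto simp: mem_box_cart not_less)
    then have "flat c 1 (x $ i - a $ i) * flat c 1 (b $ i - x $ i) = 0"
      by (auto simp: flat_def)
    then have "box_bump c a b x = 0"
      unfolding box_bump_def by (intro prod_zero) auto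
    then show ?thesis by simp
  qed
qed

lemma test_function_box_bump:
  assumes c: "0 < c"
  shows "test_function (box_bump c a b)"
  unfolding test_function_def
proof
  \<comment> \<open>Iterating the polynomial map of the derivative formula produces all successive
    derivatives of \<open>flat c 1\<close>.\<close>
  define \<psi> where "\<psi> j = flat c (((\<lambda>P. [:0, 0, 1:] * (smult c P - pderiv P)) ^^ j) 1)" for j
  have D: "(\<psi> j has_real_derivative \<psi> (Suc j) t) (at t)" for j t
    using flat_has_derivative[OF c] by (simp add: \<psi>_def)
  have "C_k k (\<lambda>x. 1 * \<psi> 0 (- (a $ i) + 1 * x $ i))" "C_k k (\<lambda>x. 1 * \<psi> 0 (b $ i + (-1) * x $ i))" for k i
    by (intro C_k_compose_coordinate D)+
  then have "C_k k (\<lambda>x. flat c 1 (x $ i - a $ i) * flat c 1 (b $ i - x $ i))" for k i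
    by (intro C_k_mult) (simp_all add: \<psi>_def)
  then show "\<forall>k. C_k k (box_bump c a b)"
    unfolding box_bump_def[abs_def] by (auto intro: C_k_prod)
  have "{x. box_bump c a b x \<noteq> 0} \<subseteq> cbox a b"
  proof
    fix x assume "x \<in> {x. box_bump c a b x \<noteq> 0}"
    then have "x \<in> box a b"
      using box_bump_bounds[OF c, of a b x] by (cases "x \<in> box a b") auto
    then show "x \<in> cbox a b" using box_subset_cbox by blast
  qed
  then show "compact (closure {x. box_bump c a b x \<noteq> 0})"
    by (meson bounded_cbox bounded_subset compact_closure)
qed

lemma box_bump_tendsto: "(\<lambda>m. box_bump (1 / real (Suc m)) a b x) \<longlonglongrightarrow> indicator (box a b) x"
proof (cases "x \<in> box a b")
  case True
  have "(\<lambda>m. flat (1 / real (Suc m)) 1 t) \<longlonglongrightarrow> 1" if "0 < t" for t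
  proof -
    have "(\<lambda>m. exp (- (inverse (real (Suc m))) / t)) \<longlonglongrightarrow> exp (- 0 / t)"
      using that by (intro tendsto_exp tendsto_divide tendsto_minus LIMSEQ_inverse_real_of_nat tendsto_const) auto
    then show ?thesis using that by (simp add: flat_def inverse_eq_divide)
  qed
  then have "(\<lambda>m. box_bump (1 / real (Suc m)) a b x) \<longlonglongrightarrow> (\<Prod>i\<in>(UNIV :: 'a set). 1 * 1)"
    unfolding box_bump_def using True by (intro tendsto_prod tendsto_mult) (auto simp: mem_box_cart)
  then show ?thesis using True by simp
next
  case False
  then have "box_bump (1 / real (Suc m)) a b x = 0" for m
    using box_bump_bounds[of "1 / real (Suc m)" a b x] by simp
  then show ?thesis using False by simp
qed

section \<open>The fundamental lemma of the calculus of variations\<close>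

lemma enn2real_cancel: "enn2real a = enn2real b \<Longrightarrow> a < top \<Longrightarrow> b < top \<Longrightarrow> a = b"
  by (metis ennreal_enn2real)

text \<open>Since \<open>ennreal\<close> truncates negative reals to 0, \<open>?P\<close> and
  \<open>?N\<close> are the positive and negative parts of \<open>u\<close>. As densities they give
  equal finite mass to every box; boxes form an intersection-stable generator, so the measures and
  hence the densities agree.\<close>

lemma AE_eq_0_if_box_integrals_eq_0:
  fixes u :: "'a::euclidean_space \<Rightarrow> real"
  assumes [measurable]: "u \<in> borel_measurable borel"
    and int: "\<And>a b. set_integrable lborel (box a b) u"
    and zero: "\<And>a b. (LINT x:box a b|lborel. u x) = 0"
  shows "AE x in lborel. u x = 0"
proof -
  let ?P = "\<lambda>x. ennreal (u x)" and ?N = "\<lambda>x. ennreal (- u x)"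
  have eq: "emeasure (density lborel ?P) (box a b) = emeasure (density lborel ?N) (box a b)"
    and fin: "emeasure (density lborel ?P) (box a b) \<noteq> \<infinity>" for a b :: 'a
  proof -
    let ?v = "\<lambda>x. indicator (box a b) x *\<^sub>R u x"
    have v: "integrable lborel ?v" by (rule int[unfolded set_integrable_def])
    have z: "integral\<^sup>L lborel ?v = 0" by (rule zero[unfolded set_lebesgue_integral_def])
    have P: "(\<integral>\<^sup>+x\<in>box a b. ?P x \<partial>lborel) = (\<integral>\<^sup>+x. ennreal (?v x) \<partial>lborel)"
      and N: "(\<integral>\<^sup>+x\<in>box a b. ?N x \<partial>lborel) = (\<integral>\<^sup>+x. ennreal (- ?v x) \<partial>lborel)"
      by (auto intro!: nn_integral_cong split: split_indicator)
    have fin': "(\<integral>\<^sup>+x. ennreal (?v x) \<partial>lborel) \<noteq> \<infinity>" "(\<integral>\<^sup>+x. ennreal (- ?v x) \<partial>lborel) \<noteq> \<infinity>"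
      using v by (auto simp: real_integrable_def)
    have "enn2real (\<integral>\<^sup>+x. ennreal (?v x) \<partial>lborel) = enn2real (\<integral>\<^sup>+x. ennreal (- ?v x) \<partial>lborel)"
      using real_lebesgue_integral_def[OF v] z by simp
    then have "(\<integral>\<^sup>+x. ennreal (?v x) \<partial>lborel) = (\<integral>\<^sup>+x. ennreal (- ?v x) \<partial>lborel)"
      using fin' by (intro enn2real_cancel) (auto simp: less_top[symmetric])
    then show "emeasure (density lborel ?P) (box a b) = emeasure (density lborel ?N) (box a b)"
      by (subst (1 2) emeasure_density) (simp_all only: P N, simp_all)
    show "emeasure (density lborel ?P) (box a b) \<noteq> \<infinity>"
      using fin'(1) by (subst emeasure_density) (simp_all only: P, simp_all)
  qed
  have dens: "density lborel ?P = density lborel ?N"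
  proof (rule measure_eqI_generator_eq)
    let ?E = "range (\<lambda>(a, b). box a b :: 'a set)"
    show "Int_stable ?E" by (auto simp: Int_stable_def box_Int_box)
    show "?E \<subseteq> Pow UNIV" "sets (density lborel ?P) = sigma_sets UNIV ?E"
      "sets (density lborel ?N) = sigma_sets UNIV ?E"
      by (simp_all add: borel_eq_box)
    let ?A = "\<lambda>n::nat. box (- (real n *\<^sub>R One)) (real n *\<^sub>R One) :: 'a set"
    show "range ?A \<subseteq> ?E" "(\<Union>i. ?A i) = UNIV"
      unfolding UN_box_eq_UNIV by auto
    show "emeasure (density lborel ?P) (?A i) \<noteq> \<infinity>" for i by (rule fin)
    show "emeasure (density lborel ?P) X = emeasure (density lborel ?N) X" if "X \<in> ?E" for X
      using that eq by auto
  qed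
  have "AE x in lborel. ?P x = ?N x"
    by (rule sigma_finite_measure.density_unique[OF sigma_finite_lborel _ _ dens]) simp_all
  then show ?thesis
  proof eventually_elim
    case (elim x)
    show ?case
    proof (cases "0 \<le> u x")
      case True
      then have "ennreal (u x) = 0" using elim by (simp add: ennreal_neg)
      then show ?thesis using True by (simp add: ennreal_eq_0_iff)
    next
      case False
      then have "ennreal (- u x) = 0" using elim by (simp add: ennreal_neg)
      then show ?thesis using False by (simp add: ennreal_eq_0_iff)
    qed
  qed
qed

text \<open>Bumps inside a box converge pointwise to its indicator and stay below it, so dominated
  convergence turns test integrals into box integrals.\<close>

lemma AE_eq_0_if_test_integrals_eq_0:
  fixes u :: "real^'n \<Rightarrow> real"
  assumes [measurable]: "u \<in> borel_measurable borel"
    and int: "\<And>a b. set_integrable lborel (box a b) u"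
    and zero: "\<And>\<phi>. test_function \<phi> \<Longrightarrow> (LINT x|lborel. u x * \<phi> x) = 0"
  shows "AE x in lborel. u x = 0"
proof (rule AE_eq_0_if_box_integrals_eq_0)
  fix a b :: "real^'n"
  let ?s = "\<lambda>m x. u x * box_bump (1 / real (Suc m)) a b x"
  have "(\<lambda>m. integral\<^sup>L lborel (?s m)) \<longlonglongrightarrow> (LINT x|lborel. u x * indicator (box a b) x)"
  proof (rule integral_dominated_convergence)
    show "integrable lborel (\<lambda>x. norm (indicator (box a b) x *\<^sub>R u x))"
      using int[of a b] unfolding set_integrable_def by (rule integrable_norm)
    have "box_bump (1 / real (Suc m)) a b \<in> borel_measurable borel" for m
      using test_function_box_bump[of "1 / real (Suc m)" a b]
      by (auto intro!: borel_measurable_continuous_onI simp: test_function_def dest: spec[of _ 0])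
    then show "?s m \<in> borel_measurable lborel" for m by simp
    show "AE x in lborel. (\<lambda>m. ?s m x) \<longlonglongrightarrow> u x * indicator (box a b) x"
      by (intro AE_I2 tendsto_mult tendsto_const box_bump_tendsto)
    show "AE x in lborel. norm (?s m x) \<le> norm (indicator (box a b) x *\<^sub>R u x)" for m
    proof (intro AE_I2)
      fix x
      show "norm (?s m x) \<le> norm (indicator (box a b) x *\<^sub>R u x)"
        using box_bump_bounds[of "1 / real (Suc m)" a b x]
        by (auto simp: abs_mult mult.commute[of _ "\<bar>u x\<bar>"] intro!: mult_left_mono)
    qed
  qed simp
  moreover have "integral\<^sup>L lborel (?s m) = 0" for m
    by (intro zero test_function_box_bump) simp
  ultimately have "(LINT x|lborel. u x * indicator (box a b) x) = 0"
    by (simp add: LIMSEQ_const_iff)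
  then show "(LINT x:box a b|lborel. u x) = 0"
    by (simp add: set_lebesgue_integral_def mult.commute)
qed (rule assms(1) int)+

section \<open>Difference quotients and weak gradients\<close>

lemma test_functionD:
  assumes "test_function \<phi>"
  shows "continuous_on UNIV \<phi>" "\<phi> differentiable (at x)"
    "\<phi> \<in> borel_measurable borel"
proof -
  show "continuous_on UNIV \<phi>" using assms by (auto simp: test_function_def dest: spec[of _ 0])
  then show "\<phi> \<in> borel_measurable borel" by (rule borel_measurable_continuous_onI)
  have "C_k (Suc 0) \<phi>" using assms by (simp only: test_function_def)
  then show "\<phi> differentiable (at x)" by simp
qed

lemma test_function_bounds:
  assumes "test_function \<phi>"
  obtains M R where "\<And>x. \<bar>\<phi> x\<bar> \<le> M" "\<And>x. \<phi> x \<noteq> 0 \<Longrightarrow> norm x \<le> R" "0 \<le> M"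
proof -
  let ?S = "closure {x. \<phi> x \<noteq> 0}"
  have S: "compact ?S" using assms by (simp add: test_function_def)
  have "continuous_on ?S \<phi>" using test_functionD(1)[OF assms] continuous_on_subset by blast
  then have "bounded (\<phi> ` ?S)" using S by (intro compact_imp_bounded compact_continuous_image)
  then obtain M where M: "\<And>x. x \<in> ?S \<Longrightarrow> \<bar>\<phi> x\<bar> \<le> M" by (auto simp: bounded_iff)
  obtain R where R: "\<And>x. x \<in> ?S \<Longrightarrow> norm x \<le> R"
    using compact_imp_bounded[OF S] by (auto simp: bounded_iff)
  have in_S: "\<phi> x \<noteq> 0 \<Longrightarrow> x \<in> ?S" for x using closure_subset[of "{x. \<phi> x \<noteq> 0}"] by auto
  show thesis
  proof (rule that[of "max M 0" R])
    show "\<bar>\<phi> x\<bar> \<le> max M 0" for x using M[of x] in_S[of x] by (cases "\<phi> x = 0") auto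
  qed (use R in_S in auto)
qed

lemma test_function_partial_derivative:
  assumes "test_function \<phi>"
  shows "test_function (partial_derivative i \<phi>)"
  unfolding test_function_def
proof
  have "C_k (Suc k) \<phi>" for k using assms by (simp only: test_function_def)
  then show "\<forall>k. C_k k (partial_derivative i \<phi>)" by simp
  have "partial_derivative i \<phi> x = 0" if "x \<notin> closure {x. \<phi> x \<noteq> 0}" for x
  proof -
    have "(\<phi> has_derivative (\<lambda>_. 0)) (at x)"
    proof (rule has_derivative_transform_within_open)
      show "((\<lambda>_. 0) has_derivative (\<lambda>_. 0)) (at x)" by simp
      show "open (- closure {x. \<phi> x \<noteq> 0})" by (rule open_Compl) simp
      show "x \<in> - closure {x. \<phi> x \<noteq> 0}" using that by (simp only: Compl_iff not_False_eq_True)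
      show "0 = \<phi> y" if "y \<in> - closure {x. \<phi> x \<noteq> 0}" for y
        using that closure_subset[of "{x. \<phi> x \<noteq> 0}"] by auto
    qed
    then show ?thesis by (simp add: partial_derivative_eq)
  qed
  then have "{x. partial_derivative i \<phi> x \<noteq> 0} \<subseteq> closure {x. \<phi> x \<noteq> 0}" by blast
  then have "bounded {x. partial_derivative i \<phi> x \<noteq> 0}"
    using assms by (auto simp: test_function_def intro: bounded_subset compact_imp_bounded)
  then show "compact (closure {x. partial_derivative i \<phi> x \<noteq> 0})"
    by simp
qed

lemma differentiable_translate:
  fixes \<phi> :: "'a::real_normed_vector \<Rightarrow> real"
  shows "(\<And>x. \<phi> differentiable (at x)) \<Longrightarrow> (\<lambda>x. \<phi> (x - c)) differentiable (at x)"
  by (rule differentiable_compose[of \<phi>]) auto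

lemma partial_derivative_translate:
  assumes "\<And>x. \<phi> differentiable (at x)"
  shows "partial_derivative i (\<lambda>x. \<phi> (x - c)) = (\<lambda>x. partial_derivative i \<phi> (x - c))"
proof
  fix x
  have "((\<lambda>x. x - c) has_derivative (\<lambda>h. h)) (at x)" by (auto intro!: derivative_eq_intros)
  then have "((\<lambda>x. \<phi> (x - c)) has_derivative frechet_derivative \<phi> (at (x - c))) (at x)"
    by (rule has_derivative_compose) (use assms in \<open>simp flip: frechet_derivative_works\<close>)
  then show "partial_derivative i (\<lambda>x. \<phi> (x - c)) x = partial_derivative i \<phi> (x - c)"
    by (subst partial_derivative_eq) (simp_all add: partial_derivative_def)
qed

lemma C_k_translate: "C_k k \<phi> \<Longrightarrow> C_k k (\<lambda>x. \<phi> (x - c))"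
proof (induction k arbitrary: \<phi>)
  case 0
  then show ?case
    by (auto intro!: continuous_on_compose2[of UNIV \<phi>] continuous_intros)
next
  case (Suc k)
  then show ?case
    unfolding C_k.simps by (simp add: differentiable_translate partial_derivative_translate)
qed

lemma test_function_translate:
  assumes "test_function \<phi>"
  shows "test_function (\<lambda>x. \<phi> (x - c))"
  unfolding test_function_def
proof
  show "\<forall>k. C_k k (\<lambda>x. \<phi> (x - c))" using assms by (simp add: test_function_def C_k_translate)
  obtain M R where R: "\<And>x. \<phi> x \<noteq> 0 \<Longrightarrow> norm x \<le> R" using test_function_bounds[OF assms] by metis
  have "norm x \<le> R + norm c" if "\<phi> (x - c) \<noteq> 0" for x
    using R[OF that] norm_triangle_sub[of x c] by linarith
  then have "bounded {x. \<phi> (x - c) \<noteq> 0}" by (auto simp: bounded_iff)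
  then show "compact (closure {x. \<phi> (x - c) \<noteq> 0})" by simp
qed

lemma
  fixes F :: "'a::euclidean_space \<Rightarrow> 'b::{banach, second_countable_topology}"
  assumes [measurable]: "F \<in> borel_measurable borel"
  shows integrable_lborel_translate: "integrable lborel (\<lambda>x. F (x + c)) \<longleftrightarrow> integrable lborel F"
    and integral_lborel_translate: "(LINT x|lborel. F (x + c)) = (LINT x|lborel. F x)"
proof -
  have "integrable lborel F \<longleftrightarrow> integrable (distr lborel borel ((+) c)) F"
    by (simp only: lborel_distr_plus)
  then show "integrable lborel (\<lambda>x. F (x + c)) \<longleftrightarrow> integrable lborel F"
    by (simp add: integrable_distr_eq add.commute)
  have "(LINT x|lborel. F x) = (LINT x|distr lborel borel ((+) c). F x)"
    by (simp only: lborel_distr_plus)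
  then show "(LINT x|lborel. F (x + c)) = (LINT x|lborel. F x)"
    by (simp add: integral_distr add.commute)
qed

section \<open>Pairing a locally integrable function with a bounded function of bounded
  support\<close>

context
  fixes k \<psi> :: "'a::euclidean_space \<Rightarrow> real" and M R :: real
  assumes k [measurable]: "k \<in> borel_measurable borel"
    and \<psi> [measurable]: "\<psi> \<in> borel_measurable borel"
    and k_int: "\<And>r. integrable lborel (\<lambda>x. indicator (cball 0 r) x *\<^sub>R k x)"
    and M: "\<And>x. \<bar>\<psi> x\<bar> \<le> M" and R: "\<And>x. \<psi> x \<noteq> 0 \<Longrightarrow> norm x \<le> R"
begin

text \<open>All translates of \<psi> by vectors of length at most \<open>r\<close> live on one ball,
  so the bound is uniform in \<open>c\<close>. Only boundedness of \<psi> and of its support is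
  used, so that test functions and indicators of boxes are both covered.\<close>

lemma nn_integral_local_bound:
  assumes "norm c \<le> r"
  shows "(\<integral>\<^sup>+x. ennreal \<bar>k x * \<psi> (x - c)\<bar> \<partial>lborel) \<le>
    ennreal M * (\<integral>\<^sup>+x. ennreal \<bar>indicator (cball 0 (R + r)) x *\<^sub>R k x\<bar> \<partial>lborel)"
proof -
  have "M \<ge> 0" using M[of 0] by simp
  have "\<bar>k x * \<psi> (x - c)\<bar> \<le> M * \<bar>indicator (cball 0 (R + r)) x *\<^sub>R k x\<bar>" for x
  proof (cases "\<psi> (x - c) = 0")
    case False
    then have "norm x \<le> R + r"
      using R[of "x - c"] norm_triangle_sub[of x c] assms by linarith
    then show ?thesis using mult_right_mono[OF M[of "x - c"], of "\<bar>k x\<bar>"]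
      by (simp add: abs_mult mult.commute)
  qed (use \<open>M \<ge> 0\<close> in simp)
  then have "(\<integral>\<^sup>+x. ennreal \<bar>k x * \<psi> (x - c)\<bar> \<partial>lborel) \<le>
      (\<integral>\<^sup>+x. ennreal M * ennreal \<bar>indicator (cball 0 (R + r)) x *\<^sub>R k x\<bar> \<partial>lborel)"
    using \<open>M \<ge> 0\<close> by (intro nn_integral_mono) (simp flip: ennreal_mult)
  moreover have "(\<lambda>x. indicator (cball 0 (R + r)) x *\<^sub>R k x) \<in> borel_measurable borel"
    using k_int[of "R + r"] by (auto dest: borel_measurable_integrable)
  ultimately show ?thesis by (subst (asm) nn_integral_cmult) simp_all
qed

lemma local_bound_finite:
  "ennreal M * (\<integral>\<^sup>+x. ennreal \<bar>indicator (cball 0 r) x *\<^sub>R k x\<bar> \<partial>lborel) < \<infinity>"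
  using k_int[of r] by (auto simp: integrable_iff_bounded ennreal_mult_less_top)

lemma integrable_local_translate: "integrable lborel (\<lambda>x. k x * \<psi> (x - c))"
  using nn_integral_local_bound[OF order_refl, of c] local_bound_finite[of "R + norm c"]
  by (auto simp: integrable_iff_bounded intro: le_less_trans)

lemma integrable_local_translate': "integrable lborel (\<lambda>x. k (x + c) * \<psi> x)"
  using integrable_local_translate[of c] integrable_lborel_translate[of "\<lambda>x. k x * \<psi> (x - c)" c]
  by simp

text \<open>These justify exchanging the order of integration in the segment parameter and in
  \<open>x\<close>. The points \<open>t *\<^sub>R h\<close> stay within distance
  \<open>norm h\<close> of 0, and a translation in \<open>x\<close> carries one integrand to the
  other.\<close>

lemma integrable_local_segment:
  "integrable (lborel \<Otimes>\<^sub>M lborel) (\<lambda>(t, x). indicator {0..1::real} t * (k x * \<psi> (x - t *\<^sub>R h)))"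
  "integrable (lborel \<Otimes>\<^sub>M lborel) (\<lambda>(t, x). indicator {0..1::real} t * (k (x + t *\<^sub>R h) * \<psi> x))"
proof -
  define B where "B = ennreal M * (\<integral>\<^sup>+x. ennreal \<bar>indicator (cball 0 (R + norm h)) x *\<^sub>R k x\<bar> \<partial>lborel)"
  have B: "B < \<infinity>" unfolding B_def by (rule local_bound_finite)
  have unshifted: "(\<integral>\<^sup>+x. ennreal \<bar>indicator {0..1::real} t * (k x * \<psi> (x - t *\<^sub>R h))\<bar> \<partial>lborel) \<le>
      B * indicator {0..1} t" for t
  proof (cases "t \<in> {0..1}")
    case True
    then have "norm (t *\<^sub>R h) \<le> norm h" by (simp add: mult_left_le_one_le)
    then show ?thesis using nn_integral_local_bound[of "t *\<^sub>R h" "norm h"] True by (simp add: B_def)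
  qed simp
  have shifted: "(\<integral>\<^sup>+x. ennreal \<bar>indicator {0..1::real} t * (k (x + t *\<^sub>R h) * \<psi> x)\<bar> \<partial>lborel) \<le>
      B * indicator {0..1} t" for t
    using unshifted[of t] nn_integral_lborel_translate[of
        "\<lambda>x. ennreal \<bar>indicator {0..1::real} t * (k x * \<psi> (x - t *\<^sub>R h))\<bar>" "t *\<^sub>R h"] by simp
  have fin: "(\<integral>\<^sup>+t. B * indicator {0..1::real} t \<partial>lborel) < \<infinity>"
    using B by (simp add: nn_integral_cmult)
  show "integrable (lborel \<Otimes>\<^sub>M lborel) (\<lambda>(t, x). indicator {0..1::real} t * (k x * \<psi> (x - t *\<^sub>R h)))"
  proof (rule integrableI_bounded)
    have "(\<integral>\<^sup>+z. ennreal (norm (case z of (t, x) \<Rightarrow> indicator {0..1::real} t * (k x * \<psi> (x - t *\<^sub>R h)))) \<partial>(lborel \<Otimes>\<^sub>M lborel))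
      = (\<integral>\<^sup>+t. \<integral>\<^sup>+x. ennreal \<bar>indicator {0..1::real} t * (k x * \<psi> (x - t *\<^sub>R h))\<bar> \<partial>lborel \<partial>lborel)"
      by (subst lborel.nn_integral_fst[symmetric]) (simp_all add: split_beta')
    also have "\<dots> \<le> (\<integral>\<^sup>+t. B * indicator {0..1::real} t \<partial>lborel)"
      by (intro nn_integral_mono unshifted)
    finally show "(\<integral>\<^sup>+z. ennreal (norm (case z of (t, x) \<Rightarrow> indicator {0..1::real} t * (k x * \<psi> (x - t *\<^sub>R h)))) \<partial>(lborel \<Otimes>\<^sub>M lborel)) < \<infinity>"
      using fin by simp
  qed measurable
  show "integrable (lborel \<Otimes>\<^sub>M lborel) (\<lambda>(t, x). indicator {0..1::real} t * (k (x + t *\<^sub>R h) * \<psi> x))"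
  proof (rule integrableI_bounded)
    have "(\<integral>\<^sup>+z. ennreal (norm (case z of (t, x) \<Rightarrow> indicator {0..1::real} t * (k (x + t *\<^sub>R h) * \<psi> x))) \<partial>(lborel \<Otimes>\<^sub>M lborel))
      = (\<integral>\<^sup>+t. \<integral>\<^sup>+x. ennreal \<bar>indicator {0..1::real} t * (k (x + t *\<^sub>R h) * \<psi> x)\<bar> \<partial>lborel \<partial>lborel)"
      by (subst lborel.nn_integral_fst[symmetric]) (simp_all add: split_beta')
    also have "\<dots> \<le> (\<integral>\<^sup>+t. B * indicator {0..1::real} t \<partial>lborel)"
      by (intro nn_integral_mono shifted)
    finally show "(\<integral>\<^sup>+z. ennreal (norm (case z of (t, x) \<Rightarrow> indicator {0..1::real} t * (k (x + t *\<^sub>R h) * \<psi> x))) \<partial>(lborel \<Otimes>\<^sub>M lborel)) < \<infinity>"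
      using fin by simp
  qed measurable
qed

end

text \<open>The fundamental theorem of calculus along the segment traversed from \<open>x\<close>
  back to \<open>x - h\<close>. The direction is backwards because a forward shift of
  \<open>f\<close> becomes a backward shift of the test function.\<close>

lemma test_function_segment:
  fixes \<phi> :: "real^'n \<Rightarrow> real"
  assumes "test_function \<phi>"
  shows "(LINT t|lborel. indicator {0..1} t * (\<Sum>i\<in>UNIV. h $ i * partial_derivative i \<phi> (x - t *\<^sub>R h))) = \<phi> x - \<phi> (x - h)"
proof -
  let ?D = "\<lambda>t. \<Sum>i\<in>UNIV. h $ i * partial_derivative i \<phi> (x - t *\<^sub>R h)"
  have cont: "continuous_on UNIV (partial_derivative i \<phi>)" for i
    using assms by (intro test_functionD test_function_partial_derivative)
  have deriv: "((\<lambda>t. - \<phi> (x - t *\<^sub>R h)) has_vector_derivative ?D t) (at t within {0..1})" for t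
  proof -
    let ?F = "frechet_derivative \<phi> (at (x - t *\<^sub>R h))"
    have F: "(\<phi> has_derivative ?F) (at (x - t *\<^sub>R h))"
      using test_functionD(2)[OF assms] by (simp flip: frechet_derivative_works)
    then have lin: "linear ?F" by (rule has_derivative_linear)
    have "h = (\<Sum>i\<in>UNIV. h $ i *\<^sub>R axis i 1)" by (simp add: basis_expansion flip: scalar_mult_eq_scaleR)
    then have "?F h = (\<Sum>i\<in>UNIV. h $ i * ?F (axis i 1))"
      using linear_sum[OF lin, of "\<lambda>i. h $ i *\<^sub>R axis i 1" UNIV] by (simp add: linear_scale[OF lin])
    then have Fh: "?F h = ?D t" by (simp add: partial_derivative_def)
    have "((\<lambda>t. x - t *\<^sub>R h) has_derivative (\<lambda>s. - (s *\<^sub>R h))) (at t within {0..1})"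
      by (auto intro!: derivative_eq_intros)
    then have "((\<lambda>t. \<phi> (x - t *\<^sub>R h)) has_derivative (\<lambda>s. ?F (- (s *\<^sub>R h)))) (at t within {0..1})"
      by (rule has_derivative_compose) (rule F)
    then have "((\<lambda>t. - \<phi> (x - t *\<^sub>R h)) has_derivative (\<lambda>s. - ?F (- (s *\<^sub>R h)))) (at t within {0..1})"
      by (rule has_derivative_minus)
    then show ?thesis
      unfolding has_vector_derivative_def by (simp add: linear_neg[OF lin] linear_scale[OF lin] Fh)
  qed
  have "continuous_on {0..1} ?D"
    by (intro continuous_intros continuous_on_compose2[OF cont]) auto
  then have "(LINT t|lborel. indicator {0..1} t *\<^sub>R ?D t) = - \<phi> (x - 1 *\<^sub>R h) - - \<phi> (x - 0 *\<^sub>R h)"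
    by (intro integral_FTC_Icc deriv) auto
  then show ?thesis by simp
qed

text \<open>Tested against \<phi>, the difference of \<open>f\<close> becomes \<open>f\<close>
  against \<open>\<phi> (x - h) - \<phi> x\<close>, an integral of directional derivatives of
  translates of \<phi>. The weak gradient identity for each translate moves the derivative to
  \<open>G\<close>, and translating back gives the segment integral. The null set may depend on
  \<open>h\<close>.\<close>

lemma weak_gradient_difference:
  fixes f :: "real^'n \<Rightarrow> real" and G :: "real^'n \<Rightarrow> real^'n"
  assumes f [measurable]: "f \<in> borel_measurable borel" and G [measurable]: "G \<in> borel_measurable borel"
    and f_int: "\<And>r. integrable lborel (\<lambda>x. indicator (cball 0 r) x *\<^sub>R f x)"
    and G_int: "\<And>r. integrable lborel (\<lambda>x. indicator (cball 0 r) x *\<^sub>R G x)"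
    and weak: "\<And>\<phi> i. test_function \<phi> \<Longrightarrow>
      (LINT x|lborel. f x * partial_derivative i \<phi> x) = - (LINT x|lborel. G x $ i * \<phi> x)"
  shows "AE x in lborel. f (x + h) - f x = (LINT t|lborel. indicator {0..1} t * (G (x + t *\<^sub>R h) \<bullet> h))"
proof -
  define u where "u x = f (x + h) - f x - (LINT t|lborel. indicator {0..1} t * (G (x + t *\<^sub>R h) \<bullet> h))" for x
  have [measurable]: "u \<in> borel_measurable borel" unfolding u_def by measurable
  have Gh_int: "integrable lborel (\<lambda>x. indicator (cball 0 r) x *\<^sub>R (G x \<bullet> h))" for r
    using integrable_inner_left[OF G_int[of r], of h] by simp
  have Gi_int: "integrable lborel (\<lambda>x. indicator (cball 0 r) x *\<^sub>R (G x $ i))" for r i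
    using integrable_inner_left[OF G_int[of r], of "axis i 1"] by (simp add: inner_axis)
  have [measurable]: "(\<lambda>x. G x $ i) \<in> borel_measurable borel" for i
  proof -
    have "(\<lambda>x. G x \<bullet> axis i 1) \<in> borel_measurable borel" by measurable
    then show ?thesis by (simp add: inner_axis)
  qed
  have "AE x in lborel. u x = 0"
  proof (rule AE_eq_0_if_test_integrals_eq_0)
    fix a b :: "real^'n"
    obtain R where R: "\<And>x. x \<in> box a b \<Longrightarrow> norm x \<le> R"
      using bounded_box[of a b] by (auto simp: bounded_iff)
    let ?\<psi> = "indicator (box a b) :: real^'n \<Rightarrow> real"
    have b: "\<bar>?\<psi> x\<bar> \<le> 1" "?\<psi> x \<noteq> 0 \<Longrightarrow> norm x \<le> R" for x
      using R[of x] by (auto simp: indicator_def)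
    have "integrable lborel (\<lambda>x. f (x + h) * ?\<psi> x)"
      by (rule integrable_local_translate'[OF _ _ f_int b]) simp_all
    moreover have "integrable lborel (\<lambda>x. f (x + 0) * ?\<psi> x)"
      by (rule integrable_local_translate'[OF _ _ f_int b]) simp_all
    moreover have "integrable lborel (\<lambda>x. LINT t|lborel. indicator {0..1::real} t * (G (x + t *\<^sub>R h) \<bullet> h * ?\<psi> x))"
      using lborel_pair.integrable_snd[OF integrable_local_segment(2)[OF _ _ Gh_int b, where h=h]] by simp
    ultimately have "integrable lborel (\<lambda>x. f (x + h) * ?\<psi> x - f (x + 0) * ?\<psi> x -
        (LINT t|lborel. indicator {0..1::real} t * (G (x + t *\<^sub>R h) \<bullet> h * ?\<psi> x)))"
      by (intro Bochner_Integration.integrable_diff)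
    also have "(\<lambda>x. f (x + h) * ?\<psi> x - f (x + 0) * ?\<psi> x -
        (LINT t|lborel. indicator {0..1::real} t * (G (x + t *\<^sub>R h) \<bullet> h * ?\<psi> x))) = (\<lambda>x. ?\<psi> x *\<^sub>R u x)"
      by (auto simp: u_def fun_eq_iff split: split_indicator)
    finally show "set_integrable lborel (box a b) u" by (simp add: set_integrable_def)
  next
    fix \<phi> :: "real^'n \<Rightarrow> real" assume \<phi>: "test_function \<phi>"
    obtain M R where MR: "\<And>x. \<bar>\<phi> x\<bar> \<le> M" "\<And>x. \<phi> x \<noteq> 0 \<Longrightarrow> norm x \<le> R"
      using test_function_bounds[OF \<phi>] by metis
    have [measurable]: "\<phi> \<in> borel_measurable borel" by (rule test_functionD[OF \<phi>])
    note d\<phi> = test_function_partial_derivative[OF \<phi>]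
    have [measurable]: "partial_derivative i \<phi> \<in> borel_measurable borel" for i
      by (rule test_functionD[OF d\<phi>])
    \<comment> \<open>\<open>D\<close> is the integrand before the weak gradient is used,
      \<open>E\<close> the one after, and \<open>E'\<close> is \<open>E\<close> with the translation
      moved from \<phi> to \<open>G\<close>.\<close>
    define D where "D i t x = indicator {0..1::real} t * (f x * partial_derivative i \<phi> (x - t *\<^sub>R h))" for i t x
    define E where "E t x = indicator {0..1::real} t * (G x \<bullet> h * \<phi> (x - t *\<^sub>R h))" for t x
    define E' where "E' t x = indicator {0..1::real} t * (G (x + t *\<^sub>R h) \<bullet> h * \<phi> x)" for t x
    have D_int: "integrable (lborel \<Otimes>\<^sub>M lborel) (\<lambda>(t, x). D i t x)" for i
    proof -
      obtain M R where "\<And>x. \<bar>partial_derivative i \<phi> x\<bar> \<le> M" "\<And>x. partial_derivative i \<phi> x \<noteq> 0 \<Longrightarrow> norm x \<le> R"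
        using test_function_bounds[OF d\<phi>] by metis
      then show ?thesis
        unfolding D_def by (intro integrable_local_segment(1)[OF _ _ f_int]) simp_all
    qed
    have E'_int: "integrable (lborel \<Otimes>\<^sub>M lborel) (\<lambda>(t, x). E' t x)"
      unfolding E'_def by (intro integrable_local_segment(2)[OF _ _ Gh_int MR]) simp_all
    have f1: "integrable lborel (\<lambda>x. f (x + h) * \<phi> x)"
      by (intro integrable_local_translate'[OF _ _ f_int MR]) simp_all
    have f2: "integrable lborel (\<lambda>x. f x * \<phi> x)"
      using integrable_local_translate[OF _ _ f_int MR, where c=0] by simp
    have f3: "integrable lborel (\<lambda>x. f x * \<phi> (x - h))"
      by (intro integrable_local_translate[OF _ _ f_int MR]) simp_all
    \<comment> \<open>For fixed \<open>t\<close> this is the weak gradient identity for the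
      translate of \<phi> by \<open>t *\<^sub>R h\<close>, contracted with \<open>h\<close>.\<close>
    have inner: "(LINT x|lborel. (\<Sum>i\<in>UNIV. h $ i * D i t x)) = - (LINT x|lborel. E' t x)" for t
    proof -
      have Di: "integrable lborel (\<lambda>x. f x * partial_derivative i \<phi> (x - t *\<^sub>R h))" for i
      proof -
        obtain M R where "\<And>x. \<bar>partial_derivative i \<phi> x\<bar> \<le> M" "\<And>x. partial_derivative i \<phi> x \<noteq> 0 \<Longrightarrow> norm x \<le> R"
          using test_function_bounds[OF d\<phi>] by metis
        then show ?thesis by (intro integrable_local_translate[OF _ _ f_int]) simp_all
      qed
      have Gi: "integrable lborel (\<lambda>x. G x $ i * \<phi> (x - t *\<^sub>R h))" for i
        by (intro integrable_local_translate[OF _ _ Gi_int MR]) simp_all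
      have w: "(LINT x|lborel. f x * partial_derivative i \<phi> (x - t *\<^sub>R h)) =
          - (LINT x|lborel. G x $ i * \<phi> (x - t *\<^sub>R h))" for i
        using weak[OF test_function_translate[OF \<phi>, of "t *\<^sub>R h"], of i]
          partial_derivative_translate[OF test_functionD(2)[OF \<phi>], of i "t *\<^sub>R h"] by simp
      have "(LINT x|lborel. (\<Sum>i\<in>UNIV. h $ i * D i t x)) =
          (\<Sum>i\<in>UNIV. h $ i * (indicator {0..1} t * (LINT x|lborel. f x * partial_derivative i \<phi> (x - t *\<^sub>R h))))"
        unfolding D_def by (subst Bochner_Integration.integral_sum) (use Di in simp_all)
      also have "\<dots> =
          - (LINT x|lborel. (\<Sum>i\<in>UNIV. h $ i * (indicator {0..1} t * (G x $ i * \<phi> (x - t *\<^sub>R h)))))"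
        unfolding w by (subst Bochner_Integration.integral_sum) (use Gi in \<open>simp_all add: sum_negf\<close>)
      also have "(\<lambda>x. \<Sum>i\<in>UNIV. h $ i * (indicator {0..1} t * (G x $ i * \<phi> (x - t *\<^sub>R h)))) = E t"
        by (auto simp: fun_eq_iff E_def inner_vec_def sum_distrib_left sum_distrib_right mult_ac intro!: sum.cong)
      also have "(LINT x|lborel. E t x) = (LINT x|lborel. E t (x + t *\<^sub>R h))"
        by (rule integral_lborel_translate[symmetric]) (simp add: E_def)
      also have "(\<lambda>x. E t (x + t *\<^sub>R h)) = E' t" by (simp add: E_def E'_def fun_eq_iff)
      finally show ?thesis .
    qed
    have sumD_int: "integrable (lborel \<Otimes>\<^sub>M lborel) (\<lambda>(t, x). \<Sum>i\<in>UNIV. h $ i * D i t x)"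
      unfolding split_beta' using D_int[unfolded split_beta']
      by (intro Bochner_Integration.integrable_sum integrable_mult_right) simp
    have "(LINT x|lborel. f (x + h) * \<phi> x) = (LINT x|lborel. f x * \<phi> (x - h))"
      using integral_lborel_translate[of "\<lambda>x. f x * \<phi> (x - h)" h] by simp
    then have "(LINT x|lborel. f (x + h) * \<phi> x) - (LINT x|lborel. f x * \<phi> x) =
        (LINT x|lborel. f x * (\<phi> (x - h) - \<phi> x))"
      using f2 f3 by (simp add: right_diff_distrib)
    also have "\<dots> = - (LINT x|lborel. LINT t|lborel. (\<Sum>i\<in>UNIV. h $ i * D i t x))"
    proof -
      have e: "(LINT t|lborel. (\<Sum>i\<in>UNIV. h $ i * D i t x)) = f x * (\<phi> x - \<phi> (x - h))" for x
        unfolding test_function_segment[OF \<phi>, of h x, symmetric] integral_mult_right_zero[symmetric]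
        by (intro Bochner_Integration.integral_cong)
          (auto simp: D_def sum_distrib_left mult_ac)
      have "(\<lambda>x. f x * (\<phi> (x - h) - \<phi> x)) = (\<lambda>x. - (f x * (\<phi> x - \<phi> (x - h))))"
        by (simp add: fun_eq_iff algebra_simps)
      then show ?thesis unfolding e by simp
    qed
    also have "(LINT x|lborel. LINT t|lborel. (\<Sum>i\<in>UNIV. h $ i * D i t x)) =
        (LINT t|lborel. LINT x|lborel. (\<Sum>i\<in>UNIV. h $ i * D i t x))"
      using lborel_pair.Fubini_integral[OF sumD_int] .
    also have "\<dots> = - (LINT t|lborel. LINT x|lborel. E' t x)"
      by (simp add: inner)
    also have "(LINT t|lborel. LINT x|lborel. E' t x) = (LINT x|lborel. LINT t|lborel. E' t x)"
      using lborel_pair.Fubini_integral[OF E'_int] by simp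
    finally have main: "(LINT x|lborel. f (x + h) * \<phi> x) - (LINT x|lborel. f x * \<phi> x) =
        (LINT x|lborel. LINT t|lborel. E' t x)" by simp
    have "integrable lborel (\<lambda>x. LINT t|lborel. E' t x)"
      using lborel_pair.integrable_snd[OF E'_int] by simp
    then have "(LINT x|lborel. f (x + h) * \<phi> x - f x * \<phi> x - (LINT t|lborel. E' t x)) = 0"
      using f1 f2 main by simp
    moreover have "(LINT t|lborel. E' t x) = (LINT t|lborel. indicator {0..1} t * (G (x + t *\<^sub>R h) \<bullet> h)) * \<phi> x" for x
      unfolding integral_mult_left_zero[symmetric] E'_def by (simp add: mult.assoc)
    ultimately show "(LINT x|lborel. u x * \<phi> x) = 0"
      by (simp add: u_def left_diff_distrib)
  qed simp
  then show ?thesis by eventually_elim (simp add: u_def)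
qed

lemma powr_le_nn_integral_powr:
  fixes v :: "real \<Rightarrow> real" and d p :: real
  assumes p: "1 \<le> p" and d: "0 \<le> d" and v: "\<And>t. 0 \<le> v t" and [measurable]: "v \<in> borel_measurable borel"
    and le: "ennreal d \<le> (\<integral>\<^sup>+t\<in>{0<..1}. ennreal (v t) \<partial>lborel)"
  shows "ennreal (d powr p) \<le> (\<integral>\<^sup>+t\<in>{0<..1}. ennreal (v t powr p) \<partial>lborel)" (is "_ \<le> ?I")
\<comment> \<open>An infinite right-hand side is split off because \<open>(p - 1) * d powr p\<close>
  is cancelled at the end, in the reals.\<close>
proof (cases "d = 0 \<or> ?I = \<infinity>")
  case True
  then show ?thesis by auto
next
  case False
  then have d: "0 < d" using d by simp
  \<comment> \<open>The tangent to \<open>y powr p\<close> at \<open>d\<close>; integrating it gives Jensen's inequality.\<close>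
  have young: "p * d powr (p - 1) * v t \<le> v t powr p + (p - 1) * d powr p" for t
  proof (cases "v t = 0")
    case False
    then have "(v t powr p) powr (1/p) * (d powr p) powr (1 - 1/p) \<le> 1/p * v t powr p + (1 - 1/p) * d powr p"
      using p d v[of t] by (intro Youngs_inequality_0) auto
    moreover have "p * (1 - 1/p) = p - 1" using p by (simp add: field_simps)
    ultimately have "v t * d powr (p - 1) \<le> 1/p * v t powr p + (1 - 1/p) * d powr p"
      using p v[of t] by (simp add: powr_powr)
    then have "p * (v t * d powr (p - 1)) \<le> p * (1/p * v t powr p + (1 - 1/p) * d powr p)"
      using p by (intro mult_left_mono) auto
    also have "\<dots> = v t powr p + (p - 1) * d powr p"
      using p by (simp add: field_simps)
    finally show ?thesis by (simp add: mult_ac)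
  qed (use p in simp)
  obtain I where I: "0 \<le> I" "?I = ennreal I" using False by (cases ?I) auto
  have "ennreal (p * d powr p) = ennreal (p * d powr (p - 1)) * ennreal d"
    using p d powr_add[of d "p - 1" 1] by (simp flip: ennreal_mult)
  also have "\<dots> \<le> ennreal (p * d powr (p - 1)) * (\<integral>\<^sup>+t\<in>{0<..1}. ennreal (v t) \<partial>lborel)"
    by (intro mult_left_mono le) simp
  also have "\<dots> = (\<integral>\<^sup>+t\<in>{0<..1}. ennreal (p * d powr (p - 1) * v t) \<partial>lborel)"
    using p v by (subst nn_integral_cmult[symmetric]) (auto simp: ennreal_mult mult.assoc)
  also have "\<dots> \<le> (\<integral>\<^sup>+t\<in>{0<..1}. ennreal (v t powr p + (p - 1) * d powr p) \<partial>lborel)"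
    using young by (intro nn_integral_mono mult_right_mono ennreal_leI) auto
  also have "\<dots> = (\<integral>\<^sup>+t. ennreal (v t powr p) * indicator {0<..1} t +
      ennreal ((p - 1) * d powr p) * indicator {0<..1} t \<partial>lborel)"
    using p by (intro nn_integral_cong) (simp add: distrib_right)
  also have "\<dots> = ?I + ennreal ((p - 1) * d powr p)"
    by (subst nn_integral_add) (simp_all add: nn_integral_cmult)
  also have "\<dots> = ennreal (I + (p - 1) * d powr p)"
    using p I by simp
  finally have "p * d powr p \<le> I + (p - 1) * d powr p"
    using p I by (subst (asm) ennreal_le_iff) auto
  then show ?thesis using I by (simp add: algebra_simps)
qed

section \<open>Borel representatives of Lebesgue measurable functions\<close>

lemma AE_lborel_translate:
  fixes c :: "'a::euclidean_space"
  assumes "AE x in lborel. P x"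
  shows "AE x in lborel. P (c + x)"
proof -
  have "AE x in distr lborel borel ((+) c). P x" using assms by (simp only: lborel_distr_plus)
  then show ?thesis by (rule AE_distrD[rotated]) simp
qed

lemma borel_measurable_if_locally_integrable:
  fixes k :: "real^'n \<Rightarrow> 'b::euclidean_space"
  assumes "locally_integrable k"
  shows "k \<in> borel_measurable lebesgue"
proof (rule borel_measurable_LIMSEQ_metric)
  show "(\<lambda>x. indicator (cball 0 (real m)) x *\<^sub>R k x) \<in> borel_measurable lebesgue" for m
    using assms unfolding locally_integrable_def set_integrable_def
    by (blast intro: borel_measurable_integrable compact_cball)
  fix x :: "real^'n"
  obtain m0 :: nat where "norm x \<le> real m0" using real_arch_simple by blast
  then have "eventually (\<lambda>m. indicator (cball 0 (real m)) x *\<^sub>R k x = k x) sequentially"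
    by (auto simp: eventually_sequentially intro!: exI[of _ m0])
  then show "(\<lambda>m. indicator (cball 0 (real m)) x *\<^sub>R k x) \<longlonglongrightarrow> k x"
    by (rule tendsto_eventually)
qed

lemma lebesgue_ex_borel_vec:
  fixes G :: "real^'n \<Rightarrow> real^'m"
  assumes "G \<in> borel_measurable lebesgue"
  obtains G' where "G' \<in> borel_measurable borel" "AE x in lborel. G x = G' x"
proof -
  have "(\<lambda>x. G x \<bullet> axis i 1) \<in> borel_measurable lebesgue" for i
    using assms by (intro borel_measurable_inner) auto
  then have "(\<lambda>x. G x $ i) \<in> borel_measurable lebesgue" for i by (simp add: inner_axis)
  then have "\<forall>i. \<exists>g \<in> borel_measurable lborel. AE x in lborel. G x $ i = g x"
    using completion_ex_borel_measurable_real by blast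
  then obtain g where g: "\<And>i. g i \<in> borel_measurable lborel" "\<And>i. AE x in lborel. G x $ i = g i x"
    by metis
  show thesis
  proof (rule that)
    show "(\<lambda>x. \<chi> i. g i x) \<in> borel_measurable borel"
      using g(1) by (subst borel_measurable_euclidean_space) (auto simp: Basis_vec_def inner_axis)
    have "AE x in lborel. \<forall>i. G x $ i = g i x" using g(2) by (simp add: AE_all_countable)
    then show "AE x in lborel. G x = (\<chi> i. g i x)" by eventually_elim (simp add: vec_eq_iff)
  qed
qed

lemma integrable_cball_if_locally_integrable:
  fixes k :: "real^'n \<Rightarrow> 'b::euclidean_space"
  assumes "locally_integrable k" and [measurable]: "k' \<in> borel_measurable borel"
    and "AE x in lborel. k x = k' x"
  shows "integrable lborel (\<lambda>x. indicator (cball 0 r) x *\<^sub>R k' x)"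
proof -
  have [measurable]: "cball 0 r \<in> sets (borel :: (real^'n) measure)" by (rule borel_closed) simp
  have m: "(\<lambda>x. indicator (cball 0 r) x *\<^sub>R k' x) \<in> borel_measurable lborel"
    by measurable
  have int: "integrable lebesgue (\<lambda>x. indicator (cball 0 r) x *\<^sub>R k x)"
    using assms(1) by (auto simp: locally_integrable_def set_integrable_def)
  have "integrable lebesgue (\<lambda>x. indicator (cball 0 r) x *\<^sub>R k' x)"
  proof (rule integrable_cong_AE_imp[OF int])
    show "(\<lambda>x. indicator (cball 0 r) x *\<^sub>R k' x) \<in> borel_measurable lebesgue"
      using m by (rule measurable_completion)
    show "AE x in lebesgue. indicator (cball 0 r) x *\<^sub>R k x = indicator (cball 0 r) x *\<^sub>R k' x"
      using AE_completion[OF assms(3)] by eventually_elim simp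
  qed
  then show ?thesis by (simp only: integrable_completion[OF m])
qed

text \<open>Both the function and its gradient are replaced by Borel representatives, so that
  shifted compositions are jointly measurable; the weak identity only sees integrals and survives.
  Cauchy-Schwarz and Jensen on the segment formula then give \<open>g\<close> as the p-th power of
  the norm of the gradient.\<close>

lemma has_weak_gradient_segment_mean:
  fixes f :: "real^'n \<Rightarrow> real"
  assumes weak: "has_weak_gradient f G" and f' [measurable]: "f' \<in> borel_measurable borel"
    and eq: "AE x in lborel. f x = f' x" and p: "1 \<le> p"
  obtains g where "g \<in> borel_measurable borel"
    "(\<integral>\<^sup>+x. g x \<partial>lborel) = (\<integral>\<^sup>+x. ennreal (norm (G x) powr p) \<partial>lebesgue)"
    "\<And>h. AE x in lborel. ennreal (\<bar>f' (x + h) - f' x\<bar> powr p) \<le> ennreal (norm h powr p) * segment_mean g x h"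
proof -
  have loc: "locally_integrable f" "locally_integrable G" using weak by (auto simp: has_weak_gradient_def)
  obtain G' where G' [measurable]: "G' \<in> borel_measurable borel" and Geq: "AE x in lborel. G x = G' x"
    using lebesgue_ex_borel_vec[OF borel_measurable_if_locally_integrable[OF loc(2)]] .
  have [measurable]: "(\<lambda>x. G' x $ i) \<in> borel_measurable borel" for i
  proof -
    have "(\<lambda>x. G' x \<bullet> axis i 1) \<in> borel_measurable borel" by measurable
    then show ?thesis by (simp add: inner_axis)
  qed
  note f_meas = borel_measurable_if_locally_integrable[OF loc(1)]
  have G_meas: "(\<lambda>x. G x $ i) \<in> borel_measurable lebesgue" for i
  proof -
    have "(\<lambda>x. G x \<bullet> axis i 1) \<in> borel_measurable lebesgue"
      by (intro borel_measurable_inner borel_measurable_if_locally_integrable[OF loc(2)]) simp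
    then show ?thesis by (simp add: inner_axis)
  qed
  have weak': "(LINT x|lborel. f' x * partial_derivative i \<phi> x) = - (LINT x|lborel. G' x $ i * \<phi> x)"
    if \<phi>: "test_function \<phi>" for \<phi> i
  proof -
    have [measurable]: "\<phi> \<in> borel_measurable borel" "partial_derivative i \<phi> \<in> borel_measurable borel"
      using \<phi> test_function_partial_derivative by (auto intro: test_functionD)
    have m: "(\<lambda>x. f' x * partial_derivative i \<phi> x) \<in> borel_measurable lborel"
      "(\<lambda>x. G' x $ i * \<phi> x) \<in> borel_measurable lborel" by measurable
    note ml = m[THEN measurable_completion]
    have "\<phi> \<in> borel_measurable lebesgue" "partial_derivative i \<phi> \<in> borel_measurable lebesgue"
      by (rule measurable_completion, simp)+
    then have ml': "(\<lambda>x. f x * partial_derivative i \<phi> x) \<in> borel_measurable lebesgue"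
      "(\<lambda>x. G x $ i * \<phi> x) \<in> borel_measurable lebesgue"
      using f_meas G_meas[of i] by (auto intro!: borel_measurable_times)
    have e: "AE x in lebesgue. f' x * partial_derivative i \<phi> x = f x * partial_derivative i \<phi> x"
      "AE x in lebesgue. G' x $ i * \<phi> x = G x $ i * \<phi> x"
      using AE_completion[OF eq] AE_completion[OF Geq] by (eventually_elim, simp)+
    have "(LINT x|lborel. f' x * partial_derivative i \<phi> x) = (LINT x|lebesgue. f' x * partial_derivative i \<phi> x)"
      by (rule integral_completion[OF m(1), symmetric])
    also have "\<dots> = (LINT x|lebesgue. f x * partial_derivative i \<phi> x)"
      by (rule integral_cong_AE[OF ml(1) ml'(1) e(1)])
    also have "\<dots> = - (LINT x|lebesgue. G x $ i * \<phi> x)"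
      using weak \<phi> by (simp add: has_weak_gradient_def)
    also have "(LINT x|lebesgue. G x $ i * \<phi> x) = (LINT x|lebesgue. G' x $ i * \<phi> x)"
      by (rule integral_cong_AE[OF ml(2) ml'(2) e(2), symmetric])
    also have "\<dots> = (LINT x|lborel. G' x $ i * \<phi> x)"
      by (rule integral_completion[OF m(2)])
    finally show ?thesis .
  qed
  define g where "g x = ennreal (norm (G' x) powr p)" for x
  show thesis
  proof (rule that)
    show [measurable]: "g \<in> borel_measurable borel" unfolding g_def by measurable
    show "(\<integral>\<^sup>+x. g x \<partial>lborel) = (\<integral>\<^sup>+x. ennreal (norm (G x) powr p) \<partial>lebesgue)"
      unfolding g_def nn_integral_completion by (rule nn_integral_cong_AE) (use Geq in \<open>eventually_elim, simp\<close>)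
    fix h
    have "AE x in lborel. f' (x + h) - f' x = (LINT t|lborel. indicator {0..1} t * (G' (x + t *\<^sub>R h) \<bullet> h))"
      using weak' by (intro weak_gradient_difference f' G' integrable_cball_if_locally_integrable[OF loc(1)]
          integrable_cball_if_locally_integrable[OF loc(2)] eq Geq) auto
    then show "AE x in lborel. ennreal (\<bar>f' (x + h) - f' x\<bar> powr p) \<le> ennreal (norm h powr p) * segment_mean g x h"
    proof eventually_elim
      case (elim x)
      let ?v = "\<lambda>t. norm (G' (x + t *\<^sub>R h)) * norm h"
      let ?F = "\<lambda>t. indicator {0..1::real} t * (G' (x + t *\<^sub>R h) \<bullet> h)"
      \<comment> \<open>If the segment integral does not exist, its default value 0 keeps the
        inequality true.\<close>
      have "ennreal \<bar>f' (x + h) - f' x\<bar> \<le> (\<integral>\<^sup>+t. ennreal (norm (?F t)) \<partial>lborel)"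
        using elim integral_norm_bound_ennreal[of lborel ?F] not_integrable_integral_eq[of lborel ?F]
        by (cases "integrable lborel ?F") auto
      also have "\<dots> \<le> (\<integral>\<^sup>+t\<in>{0<..1}. ennreal (?v t) \<partial>lborel)"
      proof (rule nn_integral_mono_AE)
        \<comment> \<open>The closed parameter interval of the difference formula and the half-open
          one of \<open>segment_mean\<close> differ only at 0.\<close>
        have "AE t in lborel. t \<noteq> (0::real)" by (rule AE_lborel_singleton)
        then show "AE t in lborel. ennreal (norm (?F t)) \<le> ennreal (?v t) * indicator {0<..1} t"
          by eventually_elim
            (auto simp: indicator_def abs_mult intro!: ennreal_leI Cauchy_Schwarz_ineq2)
      qed
      finally have "ennreal (\<bar>f' (x + h) - f' x\<bar> powr p) \<le> (\<integral>\<^sup>+t\<in>{0<..1}. ennreal (?v t powr p) \<partial>lborel)"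
        by (intro powr_le_nn_integral_powr p) auto
      also have "\<dots> = ennreal (norm h powr p) * segment_mean g x h"
        unfolding segment_mean_def
        by (subst nn_integral_cmult[symmetric])
          (auto simp: g_def powr_mult ennreal_mult mult_ac intro!: nn_integral_cong)
      finally show ?case .
    qed
  qed
qed

section \<open>Shell bounds for the Gagliardo kernels\<close>

text \<open>Also used with \<alpha> = 1, where its integral is not the seminorm and only shells of
  it are integrated. The pair has \<open>h\<close> first, so that iterated integrals have
  \<open>x\<close> inside, as in the weak-type bound.\<close>

definition gagliardo_kernel :: "real \<Rightarrow> real \<Rightarrow> (real^'n \<Rightarrow> real) \<Rightarrow> (real^'n) \<times> (real^'n) \<Rightarrow> real" where
  "gagliardo_kernel \<alpha> p f = (\<lambda>(h, x). \<bar>f (x + h) - f x\<bar> powr p / norm h powr (real CARD('n) + \<alpha> * p))"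

lemma gagliardo_kernel_nonneg: "0 \<le> gagliardo_kernel \<alpha> p f z"
  by (simp add: gagliardo_kernel_def split_beta)

lemma borel_measurable_gagliardo_kernel [measurable]:
  assumes [measurable]: "f \<in> borel_measurable borel"
  shows "gagliardo_kernel \<alpha> p f \<in> borel_measurable (lborel \<Otimes>\<^sub>M lborel)"
  unfolding gagliardo_kernel_def by measurable

text \<open>For almost every \<open>x\<close> the values at \<open>x\<close> agree, and translating
  the null set by \<open>x\<close> shows that the values at \<open>x + h\<close> agree for almost
  every \<open>h\<close>. Borel measurability then permits Tonelli on the product.\<close>

lemma gagliardo_seminorm_eq:
  fixes f :: "real^'n \<Rightarrow> real"
  assumes [measurable]: "f' \<in> borel_measurable borel" and eq: "AE x in lborel. f x = f' x"
  shows "gagliardo_seminorm \<alpha> p f =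
    ennreal_powr (\<integral>\<^sup>+z. ennreal (gagliardo_kernel \<alpha> p f' z) \<partial>(lborel \<Otimes>\<^sub>M lborel)) (1 / p)"
proof -
  have "(\<integral>\<^sup>+x. (\<integral>\<^sup>+h. ennreal (\<bar>f (x + h) - f x\<bar> powr p / norm h powr (real CARD('n) + \<alpha> * p)) \<partial>lebesgue) \<partial>lebesgue)
    = (\<integral>\<^sup>+x. (\<integral>\<^sup>+h. ennreal (gagliardo_kernel \<alpha> p f' (h, x)) \<partial>lborel) \<partial>lborel)"
    unfolding nn_integral_completion
  proof (rule nn_integral_cong_AE)
    show "AE x in lborel. (\<integral>\<^sup>+h. ennreal (\<bar>f (x + h) - f x\<bar> powr p / norm h powr (real CARD('n) + \<alpha> * p)) \<partial>lborel) =
        (\<integral>\<^sup>+h. ennreal (gagliardo_kernel \<alpha> p f' (h, x)) \<partial>lborel)"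
      using eq
    proof eventually_elim
      case (elim x)
      show ?case
        by (rule nn_integral_cong_AE, use AE_lborel_translate[OF eq, of x] in eventually_elim)
          (simp add: elim gagliardo_kernel_def)
    qed
  qed
  also have "\<dots> = (\<integral>\<^sup>+h. (\<integral>\<^sup>+x. ennreal (gagliardo_kernel \<alpha> p f' (h, x)) \<partial>lborel) \<partial>lborel)"
    by (rule lborel_pair.Fubini'[symmetric]) (simp add: split_beta')
  also have "\<dots> = (\<integral>\<^sup>+z. ennreal (gagliardo_kernel \<alpha> p f' z) \<partial>(lborel \<Otimes>\<^sub>M lborel))"
    by (subst lborel.nn_integral_fst[symmetric]) simp_all
  finally show ?thesis by (simp add: gagliardo_seminorm_def)
qed

text \<open>The two hypotheses match the powers of the difference and of \<open>norm h\<close>; the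
  dimension in the exponents is reproduced because the weights add up to 1.\<close>

lemma gagliardo_kernel_interpolate:
  assumes \<sigma>: "p\<^sub>0 * \<sigma> + p\<^sub>2 * (1 - \<sigma>) = p\<^sub>1" and \<alpha>: "\<alpha>\<^sub>0 * p\<^sub>0 * \<sigma> + \<alpha>\<^sub>2 * p\<^sub>2 * (1 - \<sigma>) = \<alpha>\<^sub>1 * p\<^sub>1"
  shows "gagliardo_kernel \<alpha>\<^sub>1 p\<^sub>1 f z =
    gagliardo_kernel \<alpha>\<^sub>0 p\<^sub>0 f z powr \<sigma> * gagliardo_kernel \<alpha>\<^sub>2 p\<^sub>2 f z powr (1 - \<sigma>)"
proof -
  obtain h x where z: "z = (h, x)" by (cases z)
  define d where "d = \<bar>f (x + h) - f x\<bar>"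
  have "d powr p\<^sub>1 = (d powr p\<^sub>0) powr \<sigma> * (d powr p\<^sub>2) powr (1 - \<sigma>)"
    unfolding \<sigma>[symmetric] powr_add by (simp add: powr_powr)
  moreover have "(real CARD('a) + \<alpha>\<^sub>0 * p\<^sub>0) * \<sigma> + (real CARD('a) + \<alpha>\<^sub>2 * p\<^sub>2) * (1 - \<sigma>) = real CARD('a) + \<alpha>\<^sub>1 * p\<^sub>1"
    unfolding \<alpha>[symmetric] by (simp add: algebra_simps)
  then have "norm h powr (real CARD('a) + \<alpha>\<^sub>1 * p\<^sub>1) =
      (norm h powr (real CARD('a) + \<alpha>\<^sub>0 * p\<^sub>0)) powr \<sigma> * (norm h powr (real CARD('a) + \<alpha>\<^sub>2 * p\<^sub>2)) powr (1 - \<sigma>)"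
    unfolding powr_powr powr_add[symmetric] by simp
  ultimately show ?thesis
    by (simp add: z gagliardo_kernel_def powr_divide d_def[symmetric])
qed

text \<open>A dyadic window for \<open>y powr \<rho>\<close> is a window for \<open>y\<close> whose
  ratio depends on \<rho> alone. For negative \<rho> the order reverses and the strict inequality
  moves to the upper end; halving \<kappa> restores strictness below, which accounts for the extra
  factor 2.\<close>

lemma powr_shell:
  fixes \<rho> \<Lambda> :: real
  assumes "\<rho> \<noteq> 0" "0 < \<Lambda>"
  obtains \<kappa> where "0 < \<kappa>"
    "\<And>y. 0 < y \<Longrightarrow> \<Lambda> < y powr \<rho> \<Longrightarrow> y powr \<rho> \<le> 2 * \<Lambda> \<Longrightarrow> \<kappa> < y \<and> y \<le> 2 * 2 powr (1 / \<bar>\<rho>\<bar>) * \<kappa>"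
proof (cases "0 < \<rho>")
  case True
  show thesis
  proof (rule that)
    show "0 < \<Lambda> powr (1 / \<rho>)" using assms by simp
    fix y :: real assume y: "0 < y" "\<Lambda> < y powr \<rho>" "y powr \<rho> \<le> 2 * \<Lambda>"
    have r: "(y powr \<rho>) powr (1 / \<rho>) = y" using y True by (simp add: powr_powr)
    have "\<Lambda> powr (1 / \<rho>) < y"
      using powr_less_mono2[of "1/\<rho>" \<Lambda> "y powr \<rho>"] y assms True r by simp
    moreover have "y \<le> 2 powr (1 / \<rho>) * \<Lambda> powr (1 / \<rho>)"
      using powr_mono2[of "1/\<rho>" "y powr \<rho>" "2 * \<Lambda>"] y assms True r by (simp add: powr_mult)
    moreover have "0 \<le> 2 powr (1 / \<rho>) * \<Lambda> powr (1 / \<rho>)" by simp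
    moreover have "\<bar>\<rho>\<bar> = \<rho>" using True by simp
    ultimately show "\<Lambda> powr (1 / \<rho>) < y \<and> y \<le> 2 * 2 powr (1 / \<bar>\<rho>\<bar>) * \<Lambda> powr (1 / \<rho>)"
      by (intro conjI; (simp only:)?; linarith)
  qed
next
  case False
  then have \<rho>: "\<rho> < 0" using assms by simp
  show thesis
  proof (rule that)
    show "0 < (2 * \<Lambda>) powr (1 / \<rho>) / 2" using assms by simp
    fix y :: real assume y: "0 < y" "\<Lambda> < y powr \<rho>" "y powr \<rho> \<le> 2 * \<Lambda>"
    have r: "(y powr \<rho>) powr (1 / \<rho>) = y" using y \<rho> by (simp add: powr_powr)
    have "(2 * \<Lambda>) powr (1 / \<rho>) \<le> y"
      using powr_mono2'[of "1/\<rho>" "y powr \<rho>" "2 * \<Lambda>"] y assms \<rho> r by simp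
    moreover have "0 < (2 * \<Lambda>) powr (1 / \<rho>)" using assms by simp
    moreover have "y \<le> \<Lambda> powr (1 / \<rho>)"
      using powr_mono2'[of "1/\<rho>" \<Lambda> "y powr \<rho>"] y assms \<rho> r by simp
    moreover have "\<Lambda> powr (1 / \<rho>) = 2 powr (1 / \<bar>\<rho>\<bar>) * (2 * \<Lambda>) powr (1 / \<rho>)"
      using \<rho> assms by (simp add: powr_mult powr_minus)
    ultimately show "(2 * \<Lambda>) powr (1 / \<rho>) / 2 < y \<and>
        y \<le> 2 * 2 powr (1 / \<bar>\<rho>\<bar>) * ((2 * \<Lambda>) powr (1 / \<rho>) / 2)"
      using y(1) by simp
  qed
qed

definition shell :: "real \<Rightarrow> real \<Rightarrow> real \<Rightarrow> ennreal" where
  "shell \<Lambda> a b = (if \<Lambda> * b < a \<and> a \<le> 2 * \<Lambda> * b then ennreal b else 0)"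

lemma shell_eqI:
  assumes "a = b * r"
  shows "shell \<Lambda> a b = (if 0 < b \<and> \<Lambda> < r \<and> r \<le> 2 * \<Lambda> then ennreal b else 0)"
proof (cases "0 < b")
  case True
  then have "\<Lambda> * b < a \<longleftrightarrow> \<Lambda> < r" "a \<le> 2 * \<Lambda> * b \<longleftrightarrow> r \<le> 2 * \<Lambda>"
    unfolding assms by (simp_all add: mult.commute)
  then show ?thesis using True by (simp add: shell_def)
qed (simp add: shell_def ennreal_neg)

text \<open>With a common exponent the first kernel is the second times
  \<open>norm h powr ((1 - \<alpha>\<^sub>0) * p)\<close>, so a shell is an annulus with radii of
  ratio \<open>2 powr (1 / ((1 - \<alpha>\<^sub>0) * p))\<close>. There the kernel is at most
  \<open>norm h powr (-n)\<close> times the segment mean.\<close>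

lemma shell_bound_eq_exponents:
  fixes f :: "real^'n \<Rightarrow> real"
  assumes p: "1 \<le> p" and \<alpha>: "\<alpha>\<^sub>0 < 1"
    and [measurable]: "f \<in> borel_measurable borel" "g \<in> borel_measurable borel"
    and diff: "\<And>h. AE x in lborel. ennreal (\<bar>f (x + h) - f x\<bar> powr p) \<le> ennreal (norm h powr p) * segment_mean g x h"
    and \<Lambda>: "0 < \<Lambda>"
  shows "(\<integral>\<^sup>+h. \<integral>\<^sup>+x. shell \<Lambda> (gagliardo_kernel \<alpha>\<^sub>0 p f (h, x)) (gagliardo_kernel 1 p f (h, x)) \<partial>lborel \<partial>lborel)
    \<le> ennreal ((2 powr (1 / ((1 - \<alpha>\<^sub>0) * p))) ^ CARD('n) * unit_ball_vol (real CARD('n))) * (\<integral>\<^sup>+x. g x \<partial>lborel)"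
proof -
  define \<tau> where "\<tau> = (1 - \<alpha>\<^sub>0) * p"
  have \<tau>: "\<tau> > 0" using p \<alpha> by (simp add: \<tau>_def)
  define r where "r = \<Lambda> powr (1 / \<tau>)"
  define s :: real where "s = 2 powr (1 / \<tau>)"
  have rs: "0 < r" "0 < s" using \<Lambda> by (simp_all add: r_def s_def)
  define c where "c h = ennreal (if r < norm h \<and> norm h \<le> s * r then norm h powr (- real DIM(real^'n)) else 0)"
    for h :: "real^'n"
  have [measurable]: "c \<in> borel_measurable borel" unfolding c_def by measurable
  have pw: "shell \<Lambda> (gagliardo_kernel \<alpha>\<^sub>0 p f (h, x)) (gagliardo_kernel 1 p f (h, x)) \<le> c h * segment_mean g x h"
    if le: "ennreal (\<bar>f (x + h) - f x\<bar> powr p) \<le> ennreal (norm h powr p) * segment_mean g x h" for h x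
  proof -
    let ?b = "gagliardo_kernel 1 p f (h, x)"
    have "gagliardo_kernel \<alpha>\<^sub>0 p f (h, x) = ?b * norm h powr \<tau>"
      by (cases "h = 0") (simp_all add: gagliardo_kernel_def \<tau>_def algebra_simps powr_add powr_diff)
    then have "shell \<Lambda> (gagliardo_kernel \<alpha>\<^sub>0 p f (h, x)) ?b =
        (if 0 < ?b \<and> \<Lambda> < norm h powr \<tau> \<and> norm h powr \<tau> \<le> 2 * \<Lambda> then ennreal ?b else 0)"
      by (rule shell_eqI)
    also have "\<dots> \<le> c h * segment_mean g x h"
    proof (cases "0 < ?b \<and> \<Lambda> < norm h powr \<tau> \<and> norm h powr \<tau> \<le> 2 * \<Lambda>")
      case True
      then have h: "h \<noteq> 0" using \<Lambda> by auto
      have root: "(norm h powr \<tau>) powr (1 / \<tau>) = norm h" using \<tau> by (simp add: powr_powr)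
      have "r < norm h"
        using powr_less_mono2[of "1/\<tau>" \<Lambda> "norm h powr \<tau>"] True \<tau> \<Lambda> root by (simp add: r_def)
      moreover have "norm h \<le> s * r"
        using powr_mono2[of "1/\<tau>" "norm h powr \<tau>" "2 * \<Lambda>"] True \<tau> \<Lambda> root by (simp add: r_def s_def powr_mult)
      ultimately have c: "c h = ennreal (norm h powr (- real CARD('n)))" by (simp add: c_def)
      have "?b = norm h powr (- real CARD('n) - p) * \<bar>f (x + h) - f x\<bar> powr p"
        using h by (simp add: gagliardo_kernel_def powr_add powr_diff powr_minus divide_inverse mult_ac)
      then have "ennreal ?b = ennreal (norm h powr (- real CARD('n) - p)) * ennreal (\<bar>f (x + h) - f x\<bar> powr p)"
        by (simp add: ennreal_mult)
      also have "\<dots> \<le> ennreal (norm h powr (- real CARD('n) - p)) * (ennreal (norm h powr p) * segment_mean g x h)"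
        by (intro mult_left_mono le) simp
      also have "\<dots> = c h * segment_mean g x h"
        using h by (simp add: c mult.assoc[symmetric] flip: ennreal_mult powr_add)
      finally show ?thesis using True by simp
    qed auto
    finally show ?thesis .
  qed
  have "(\<integral>\<^sup>+h. \<integral>\<^sup>+x. shell \<Lambda> (gagliardo_kernel \<alpha>\<^sub>0 p f (h, x)) (gagliardo_kernel 1 p f (h, x)) \<partial>lborel \<partial>lborel)
     \<le> (\<integral>\<^sup>+h. \<integral>\<^sup>+x. c h * segment_mean g x h \<partial>lborel \<partial>lborel)"
  proof (rule nn_integral_mono, rule nn_integral_mono_AE)
    show "AE x in lborel. shell \<Lambda> (gagliardo_kernel \<alpha>\<^sub>0 p f (h, x)) (gagliardo_kernel 1 p f (h, x)) \<le> c h * segment_mean g x h" for h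
      using diff[of h] by eventually_elim (rule pw)
  qed
  also have "\<dots> = (\<integral>\<^sup>+h. c h \<partial>lborel) * (\<integral>\<^sup>+x. g x \<partial>lborel)"
    by (simp add: nn_integral_cmult nn_integral_segment_mean nn_integral_multc)
  also have "\<dots> \<le> ennreal (s ^ DIM(real^'n) * unit_ball_vol (real DIM(real^'n))) * (\<integral>\<^sup>+x. g x \<partial>lborel)"
    unfolding c_def by (intro mult_right_mono nn_integral_annulus_powr_le rs) simp
  finally show ?thesis by (simp add: s_def \<tau>_def)
qed

text \<open>With \<open>y\<close> the difference quotient, the second kernel is
  \<open>y * norm h powr (\<gamma> - n)\<close> and the first is the second times
  \<open>y powr \<rho>\<close>. On a shell \<open>y\<close> lies between \<kappa> and a fixed
  multiple of it, so the kernel is at most a multiple of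
  \<open>\<kappa> * norm h powr (\<gamma> - n)\<close> on an exceeding set.\<close>

lemma shell_bound_neq_exponents:
  assumes p: "1 \<le> p\<^sub>0" "1 \<le> p\<^sub>2" "p\<^sub>0 \<noteq> p\<^sub>2" and \<alpha>: "\<alpha>\<^sub>0 < 1" and less: "\<alpha>\<^sub>0 - 1 / p\<^sub>0 < 1 - 1 / p\<^sub>2"
  shows "\<exists>C>0. \<forall>(f :: real^'n \<Rightarrow> real) g \<Lambda>. f \<in> borel_measurable borel \<longrightarrow> g \<in> borel_measurable borel \<longrightarrow>
    (\<forall>h. AE x in lborel. ennreal (\<bar>f (x + h) - f x\<bar> powr p\<^sub>2) \<le> ennreal (norm h powr p\<^sub>2) * segment_mean g x h) \<longrightarrow>
    0 < \<Lambda> \<longrightarrow>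
    (\<integral>\<^sup>+h. \<integral>\<^sup>+x. shell \<Lambda> (gagliardo_kernel \<alpha>\<^sub>0 p\<^sub>0 f (h, x)) (gagliardo_kernel 1 p\<^sub>2 f (h, x)) \<partial>lborel \<partial>lborel)
    \<le> ennreal C * (\<integral>\<^sup>+x. g x \<partial>lborel)"
proof -
  define \<gamma> where "\<gamma> = (1 - \<alpha>\<^sub>0) / (1 / p\<^sub>0 - 1 / p\<^sub>2)"
  define \<rho> where "\<rho> = (p\<^sub>0 - p\<^sub>2) / p\<^sub>2"
  have \<rho>: "\<rho> \<noteq> 0" using p by (simp add: \<rho>_def)
  \<comment> \<open>The sign of \<gamma> is that of \<open>p\<^sub>2 - p\<^sub>0\<close>. When it is
    negative, clearing the negative denominator in \<gamma> < -1 gives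
    \<open>1 - \<alpha>\<^sub>0 > 1 / p\<^sub>2 - 1 / p\<^sub>0\<close>.\<close>
  have \<gamma>: "0 < \<gamma> \<or> \<gamma> < -1"
  proof (cases "p\<^sub>0 < p\<^sub>2")
    case True
    then have "1 / p\<^sub>2 < 1 / p\<^sub>0" using p by (simp add: field_simps)
    then show ?thesis using \<alpha> by (simp add: \<gamma>_def)
  next
    case False
    then have "1 / p\<^sub>0 < 1 / p\<^sub>2" using p by (simp add: field_simps)
    then show ?thesis using less by (simp add: \<gamma>_def neg_divide_less_eq)
  qed
  \<comment> \<open>The equation that determines \<gamma>: the power of \<open>norm h\<close> in
    \<open>y powr \<rho>\<close> must be the one in the quotient of the kernels.\<close>
  have exponent: "(p\<^sub>2 + \<gamma>) * \<rho> = \<alpha>\<^sub>0 * p\<^sub>0 - p\<^sub>2"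
  proof -
    have "\<gamma> * (p\<^sub>2 - p\<^sub>0) = (1 - \<alpha>\<^sub>0) * (p\<^sub>0 * p\<^sub>2)"
      using p by (simp add: \<gamma>_def field_simps)
    then have "\<gamma> * (p\<^sub>0 - p\<^sub>2) / p\<^sub>2 = - ((1 - \<alpha>\<^sub>0) * p\<^sub>0)"
      using p by (simp add: field_simps)
    moreover have "(p\<^sub>2 + \<gamma>) * \<rho> = (p\<^sub>0 - p\<^sub>2) + \<gamma> * (p\<^sub>0 - p\<^sub>2) / p\<^sub>2"
      using p by (simp add: \<rho>_def field_simps)
    ultimately show ?thesis by (simp add: algebra_simps)
  qed
  obtain C where C: "C > 0" and weak: "\<And>(g :: real^'n \<Rightarrow> ennreal) \<kappa>. g \<in> borel_measurable borel \<Longrightarrow> 0 < \<kappa> \<Longrightarrow>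
    (\<integral>\<^sup>+h. \<integral>\<^sup>+x. ennreal (of_bool (exceeds g \<kappa> \<gamma> x h) * norm h powr (\<gamma> - real DIM(real^'n))) \<partial>lborel \<partial>lborel)
      \<le> ennreal (C / \<kappa>) * (\<integral>\<^sup>+x. g x \<partial>lborel)"
    using weak_type_exceeds[OF \<gamma>, where 'a="real^'n"] by blast
  define s where "s = 2 * 2 powr (1 / \<bar>\<rho>\<bar>)"
  have s: "s > 0" by (simp add: s_def)
  show ?thesis
  proof (intro exI[of _ "s * C"] conjI allI impI)
    show "s * C > 0" using s C by simp
    fix f :: "real^'n \<Rightarrow> real" and g and \<Lambda> :: real
    assume [measurable]: "f \<in> borel_measurable borel" "g \<in> borel_measurable borel" and \<Lambda>: "0 < \<Lambda>"
      and diff: "\<forall>h. AE x in lborel. ennreal (\<bar>f (x + h) - f x\<bar> powr p\<^sub>2) \<le> ennreal (norm h powr p\<^sub>2) * segment_mean g x h"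
    obtain \<kappa> where \<kappa>: "0 < \<kappa>" and level: "\<And>y. 0 < y \<Longrightarrow> \<Lambda> < y powr \<rho> \<Longrightarrow> y powr \<rho> \<le> 2 * \<Lambda> \<Longrightarrow> \<kappa> < y \<and> y \<le> s * \<kappa>"
      using powr_shell[OF \<rho> \<Lambda>] unfolding s_def by blast
    define w where "w h x = ennreal (of_bool (exceeds g \<kappa> \<gamma> x h) * norm h powr (\<gamma> - real DIM(real^'n)))" for h x
    have [measurable]: "w h \<in> borel_measurable borel" "(\<lambda>(h, x). w h x) \<in> borel_measurable (borel \<Otimes>\<^sub>M borel)" for h
      unfolding w_def of_bool_def by measurable
    have pw: "shell \<Lambda> (gagliardo_kernel \<alpha>\<^sub>0 p\<^sub>0 f (h, x)) (gagliardo_kernel 1 p\<^sub>2 f (h, x)) \<le> ennreal (s * \<kappa>) * w h x"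
      if le: "ennreal (\<bar>f (x + h) - f x\<bar> powr p\<^sub>2) \<le> ennreal (norm h powr p\<^sub>2) * segment_mean g x h" for h x
    proof -
      let ?b = "gagliardo_kernel 1 p\<^sub>2 f (h, x)"
      define d where "d = \<bar>f (x + h) - f x\<bar>"
      define y where "y = d powr p\<^sub>2 / norm h powr (p\<^sub>2 + \<gamma>)"
      have k: "gagliardo_kernel \<alpha> p f (h, x) = d powr p / norm h powr (real CARD('n) + \<alpha> * p)" for \<alpha> p
        by (simp add: gagliardo_kernel_def d_def)
      have b: "?b = y * norm h powr (\<gamma> - real CARD('n))"
      proof (cases "h = 0")
        case False
        have "norm h powr (real CARD('n) + p\<^sub>2) * norm h powr (\<gamma> - real CARD('n)) = norm h powr (p\<^sub>2 + \<gamma>)"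
          by (simp flip: powr_add add: add_ac)
        then show ?thesis
          using False by (simp add: k y_def field_simps)
      qed (simp add: gagliardo_kernel_def)
      have "gagliardo_kernel \<alpha>\<^sub>0 p\<^sub>0 f (h, x) = ?b * y powr \<rho>"
      proof (cases "h = 0 \<or> d = 0")
        case False
        then have pos: "norm h > 0" "d > 0" by (auto simp: d_def)
        have "p\<^sub>2 * \<rho> = p\<^sub>0 - p\<^sub>2" using p by (simp add: \<rho>_def)
        then have "y powr \<rho> = d powr (p\<^sub>0 - p\<^sub>2) / norm h powr (\<alpha>\<^sub>0 * p\<^sub>0 - p\<^sub>2)"
          by (simp add: y_def powr_divide powr_powr exponent)
        then show ?thesis
          using pos by (simp add: k powr_diff powr_add)
      qed (auto simp: gagliardo_kernel_def d_def)
      then have "shell \<Lambda> (gagliardo_kernel \<alpha>\<^sub>0 p\<^sub>0 f (h, x)) ?b =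
          (if 0 < ?b \<and> \<Lambda> < y powr \<rho> \<and> y powr \<rho> \<le> 2 * \<Lambda> then ennreal ?b else 0)"
        by (rule shell_eqI)
      also have "\<dots> \<le> ennreal (s * \<kappa>) * w h x"
      proof (cases "0 < ?b \<and> \<Lambda> < y powr \<rho> \<and> y powr \<rho> \<le> 2 * \<Lambda>")
        case True
        then have h: "norm h > 0" by (cases "h = 0") (simp_all add: gagliardo_kernel_def)
        have "0 \<le> y" by (simp add: y_def)
        then have "0 < y" using True b by (cases "y = 0") auto
        then have y: "\<kappa> < y" "y \<le> s * \<kappa>" using level True by auto
        have "ennreal (norm h powr p\<^sub>2) * ennreal (\<kappa> * norm h powr \<gamma>) < ennreal (d powr p\<^sub>2)"
        proof -
          have "norm h powr p\<^sub>2 * (\<kappa> * norm h powr \<gamma>) = \<kappa> * norm h powr (p\<^sub>2 + \<gamma>)"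
            by (simp add: powr_add)
          also have "\<dots> < d powr p\<^sub>2"
            using y(1) h by (simp add: y_def less_divide_eq)
          finally show ?thesis using \<kappa> by (simp add: ennreal_less_iff flip: ennreal_mult)
        qed
        also have "\<dots> \<le> ennreal (norm h powr p\<^sub>2) * segment_mean g x h" using le by (simp add: d_def)
        finally have ex: "exceeds g \<kappa> \<gamma> x h"
          unfolding exceeds_def by (meson leD leI mult_left_mono zero_le)
        have "?b \<le> s * \<kappa> * norm h powr (\<gamma> - real CARD('n))"
          unfolding b using y by (intro mult_right_mono) auto
        then have "ennreal ?b \<le> ennreal (s * \<kappa>) * w h x"
          using ex s \<kappa> by (simp add: w_def flip: ennreal_mult)
        then show ?thesis using True by simp
      qed auto
      finally show ?thesis .
    qed
    have "(\<integral>\<^sup>+h. \<integral>\<^sup>+x. shell \<Lambda> (gagliardo_kernel \<alpha>\<^sub>0 p\<^sub>0 f (h, x)) (gagliardo_kernel 1 p\<^sub>2 f (h, x)) \<partial>lborel \<partial>lborel)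
       \<le> (\<integral>\<^sup>+h. \<integral>\<^sup>+x. ennreal (s * \<kappa>) * w h x \<partial>lborel \<partial>lborel)"
    proof (rule nn_integral_mono, rule nn_integral_mono_AE)
      show "AE x in lborel. shell \<Lambda> (gagliardo_kernel \<alpha>\<^sub>0 p\<^sub>0 f (h, x)) (gagliardo_kernel 1 p\<^sub>2 f (h, x)) \<le> ennreal (s * \<kappa>) * w h x" for h
        using diff[rule_format, of h] by eventually_elim (rule pw)
    qed
    also have "\<dots> = ennreal (s * \<kappa>) * (\<integral>\<^sup>+h. \<integral>\<^sup>+x. w h x \<partial>lborel \<partial>lborel)"
      by (simp add: nn_integral_cmult)
    \<comment> \<open>The factor \<kappa> from the size of the kernel cancels against
      \<open>C / \<kappa>\<close>, which makes the bound uniform in \<Lambda>.\<close>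
    also have "\<dots> \<le> ennreal (s * \<kappa>) * (ennreal (C / \<kappa>) * (\<integral>\<^sup>+x. g x \<partial>lborel))"
      unfolding w_def by (intro mult_left_mono weak \<kappa>) simp_all
    also have "\<dots> = ennreal (s * C) * (\<integral>\<^sup>+x. g x \<partial>lborel)"
      using s \<kappa> C by (simp add: mult.assoc[symmetric] flip: ennreal_mult)
    finally show "(\<integral>\<^sup>+h. \<integral>\<^sup>+x. shell \<Lambda> (gagliardo_kernel \<alpha>\<^sub>0 p\<^sub>0 f (h, x)) (gagliardo_kernel 1 p\<^sub>2 f (h, x)) \<partial>lborel \<partial>lborel)
       \<le> ennreal (s * C) * (\<integral>\<^sup>+x. g x \<partial>lborel)" .
  qed
qed

section \<open>The uniform shell bound and the interpolation inequality\<close>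

lemma ennreal_powr_finite:
  assumes "ennreal_powr x r < top"
  obtains B where "0 \<le> B" "x = ennreal B" "ennreal_powr x r = ennreal (B powr r)"
  using assms by (cases x) (auto simp: ennreal_powr_def)

text \<open>One form for the two definitions of the seminorm: \<open>B\<close> is its
  \<open>p\<^sub>2\<close>-th power, and \<open>k\<close> is chosen before \<open>f\<close>. For
  \<open>\<alpha>\<^sub>2 < 1\<close> a shell is dominated by the whole kernel, whose integral is
  \<open>B\<close>; for \<open>\<alpha>\<^sub>2 = 1\<close> the gradient enters through its segment
  means.\<close>

lemma sobolev_shell_bound:
  assumes "0 < \<alpha>\<^sub>0" "\<alpha>\<^sub>0 < \<alpha>\<^sub>2" "\<alpha>\<^sub>2 \<le> 1" and p: "1 \<le> p\<^sub>0" "1 \<le> p\<^sub>2"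
    and less: "\<alpha>\<^sub>0 - 1 / p\<^sub>0 < \<alpha>\<^sub>2 - 1 / p\<^sub>2"
  shows "\<exists>k>0. \<forall>f :: real^'n \<Rightarrow> real. f \<in> sobolev_space \<alpha>\<^sub>2 p\<^sub>2 \<longrightarrow>
    (\<exists>f' B. f' \<in> borel_measurable borel \<and> (AE x in lborel. f x = f' x) \<and> 0 \<le> B \<and>
      sobolev_seminorm \<alpha>\<^sub>2 p\<^sub>2 f = ennreal (B powr (1 / p\<^sub>2)) \<and>
      (\<forall>\<Lambda>>0. (\<integral>\<^sup>+z. shell \<Lambda> (gagliardo_kernel \<alpha>\<^sub>0 p\<^sub>0 f' z) (gagliardo_kernel \<alpha>\<^sub>2 p\<^sub>2 f' z) \<partial>(lborel \<Otimes>\<^sub>M lborel))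
        \<le> ennreal (k * B)))"
proof -
  have repr: "\<exists>f'. f' \<in> borel_measurable borel \<and> (AE x in lborel. f x = f' x)"
    if "f \<in> sobolev_space \<alpha>\<^sub>2 p\<^sub>2" for f :: "real^'n \<Rightarrow> real"
    using completion_ex_borel_measurable_real[of f lborel] that by (auto simp: sobolev_space_def)
  show ?thesis
  proof (cases "\<alpha>\<^sub>2 = 1")
    case False
    show ?thesis
    proof (intro exI[of _ "1::real"] conjI allI impI)
      fix f :: "real^'n \<Rightarrow> real" assume f: "f \<in> sobolev_space \<alpha>\<^sub>2 p\<^sub>2"
      obtain f' where [measurable]: "f' \<in> borel_measurable borel" and eq: "AE x in lborel. f x = f' x"
        using repr[OF f] by blast
      let ?K = "\<integral>\<^sup>+z. ennreal (gagliardo_kernel \<alpha>\<^sub>2 p\<^sub>2 f' z) \<partial>(lborel \<Otimes>\<^sub>M lborel)"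
      have sem: "sobolev_seminorm \<alpha>\<^sub>2 p\<^sub>2 f = ennreal_powr ?K (1 / p\<^sub>2)"
        using False by (simp add: sobolev_seminorm_def gagliardo_seminorm_eq[OF _ eq])
      then obtain B where B: "0 \<le> B" "?K = ennreal B" "ennreal_powr ?K (1 / p\<^sub>2) = ennreal (B powr (1 / p\<^sub>2))"
        using f ennreal_powr_finite by (auto simp: sobolev_space_def)
      have "(\<integral>\<^sup>+z. shell \<Lambda> (gagliardo_kernel \<alpha>\<^sub>0 p\<^sub>0 f' z) (gagliardo_kernel \<alpha>\<^sub>2 p\<^sub>2 f' z) \<partial>(lborel \<Otimes>\<^sub>M lborel)) \<le> ?K" for \<Lambda>
        by (intro nn_integral_mono) (simp add: shell_def)
      then show "\<exists>f' B. f' \<in> borel_measurable borel \<and> (AE x in lborel. f x = f' x) \<and> 0 \<le> B \<and>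
        sobolev_seminorm \<alpha>\<^sub>2 p\<^sub>2 f = ennreal (B powr (1 / p\<^sub>2)) \<and>
        (\<forall>\<Lambda>>0. (\<integral>\<^sup>+z. shell \<Lambda> (gagliardo_kernel \<alpha>\<^sub>0 p\<^sub>0 f' z) (gagliardo_kernel \<alpha>\<^sub>2 p\<^sub>2 f' z) \<partial>(lborel \<Otimes>\<^sub>M lborel))
        \<le> ennreal (1 * B))"
        using B sem eq by (intro exI[of _ f'] exI[of _ B]) auto
    qed simp
  next
    case True
    have shells: "\<exists>k>0. \<forall>(f :: real^'n \<Rightarrow> real) g \<Lambda>. f \<in> borel_measurable borel \<longrightarrow> g \<in> borel_measurable borel \<longrightarrow>
      (\<forall>h. AE x in lborel. ennreal (\<bar>f (x + h) - f x\<bar> powr p\<^sub>2) \<le> ennreal (norm h powr p\<^sub>2) * segment_mean g x h) \<longrightarrow>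
      0 < \<Lambda> \<longrightarrow>
      (\<integral>\<^sup>+h. \<integral>\<^sup>+x. shell \<Lambda> (gagliardo_kernel \<alpha>\<^sub>0 p\<^sub>0 f (h, x)) (gagliardo_kernel 1 p\<^sub>2 f (h, x)) \<partial>lborel \<partial>lborel)
      \<le> ennreal k * (\<integral>\<^sup>+x. g x \<partial>lborel)"
    proof (cases "p\<^sub>0 = p\<^sub>2")
      case True
      then show ?thesis
        using shell_bound_eq_exponents[of p\<^sub>2 \<alpha>\<^sub>0, where 'n='n] p assms(2,3)
        by (intro exI[of _ "(2 powr (1 / ((1 - \<alpha>\<^sub>0) * p\<^sub>2))) ^ CARD('n) * unit_ball_vol (real CARD('n))"])
          auto
    next
      case False
      then show ?thesis
        using p assms(2,3) less \<open>\<alpha>\<^sub>2 = 1\<close> by (intro shell_bound_neq_exponents) auto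
    qed
    then obtain k where k: "k > 0" and shells: "\<And>(f :: real^'n \<Rightarrow> real) g \<Lambda>. f \<in> borel_measurable borel \<Longrightarrow> g \<in> borel_measurable borel \<Longrightarrow>
      (\<And>h. AE x in lborel. ennreal (\<bar>f (x + h) - f x\<bar> powr p\<^sub>2) \<le> ennreal (norm h powr p\<^sub>2) * segment_mean g x h) \<Longrightarrow>
      0 < \<Lambda> \<Longrightarrow>
      (\<integral>\<^sup>+h. \<integral>\<^sup>+x. shell \<Lambda> (gagliardo_kernel \<alpha>\<^sub>0 p\<^sub>0 f (h, x)) (gagliardo_kernel 1 p\<^sub>2 f (h, x)) \<partial>lborel \<partial>lborel)
      \<le> ennreal k * (\<integral>\<^sup>+x. g x \<partial>lborel)" by blast
    show ?thesis
    proof (intro exI[of _ k] conjI allI impI)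
      fix f :: "real^'n \<Rightarrow> real" assume f: "f \<in> sobolev_space \<alpha>\<^sub>2 p\<^sub>2"
      obtain f' where f' [measurable]: "f' \<in> borel_measurable borel" and eq: "AE x in lborel. f x = f' x"
        using repr[OF f] by blast
      let ?G = "weak_gradient f"
      have fin: "sobolev_seminorm 1 p\<^sub>2 f < top" using f True by (simp add: sobolev_space_def)
      then have ex: "\<exists>G. has_weak_gradient f G" by (auto simp: sobolev_seminorm_def split: if_splits)
      then have weak: "has_weak_gradient f ?G" unfolding weak_gradient_def by (rule someI_ex)
      obtain g where g [measurable]: "g \<in> borel_measurable borel"
        and g_int: "(\<integral>\<^sup>+x. g x \<partial>lborel) = (\<integral>\<^sup>+x. ennreal (norm (?G x) powr p\<^sub>2) \<partial>lebesgue)"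
        and diff: "\<And>h. AE x in lborel. ennreal (\<bar>f' (x + h) - f' x\<bar> powr p\<^sub>2) \<le> ennreal (norm h powr p\<^sub>2) * segment_mean g x h"
        using has_weak_gradient_segment_mean[OF weak f' eq p(2)] by blast
      have sem: "sobolev_seminorm 1 p\<^sub>2 f = ennreal_powr (\<integral>\<^sup>+x. g x \<partial>lborel) (1 / p\<^sub>2)"
        using ex by (simp add: sobolev_seminorm_def Lp_norm_def g_int)
      then obtain B where B: "0 \<le> B" "(\<integral>\<^sup>+x. g x \<partial>lborel) = ennreal B"
        "ennreal_powr (\<integral>\<^sup>+x. g x \<partial>lborel) (1 / p\<^sub>2) = ennreal (B powr (1 / p\<^sub>2))"
        using fin ennreal_powr_finite by metis
      have "(\<integral>\<^sup>+z. shell \<Lambda> (gagliardo_kernel \<alpha>\<^sub>0 p\<^sub>0 f' z) (gagliardo_kernel 1 p\<^sub>2 f' z) \<partial>(lborel \<Otimes>\<^sub>M lborel))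
        \<le> ennreal (k * B)" if "0 < \<Lambda>" for \<Lambda>
      proof -
        have "(\<lambda>z. shell \<Lambda> (gagliardo_kernel \<alpha>\<^sub>0 p\<^sub>0 f' z) (gagliardo_kernel 1 p\<^sub>2 f' z)) \<in> borel_measurable (lborel \<Otimes>\<^sub>M lborel)"
          unfolding shell_def by measurable
        then have "(\<integral>\<^sup>+z. shell \<Lambda> (gagliardo_kernel \<alpha>\<^sub>0 p\<^sub>0 f' z) (gagliardo_kernel 1 p\<^sub>2 f' z) \<partial>(lborel \<Otimes>\<^sub>M lborel)) =
          (\<integral>\<^sup>+h. \<integral>\<^sup>+x. shell \<Lambda> (gagliardo_kernel \<alpha>\<^sub>0 p\<^sub>0 f' (h, x)) (gagliardo_kernel 1 p\<^sub>2 f' (h, x)) \<partial>lborel \<partial>lborel)"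
          by (rule lborel.nn_integral_fst[symmetric])
        also have "\<dots> \<le> ennreal k * (\<integral>\<^sup>+x. g x \<partial>lborel)"
          by (rule shells[OF f' g diff that])
        also have "\<dots> = ennreal (k * B)" using k B by (simp add: ennreal_mult)
        finally show ?thesis .
      qed
      then show "\<exists>f' B. f' \<in> borel_measurable borel \<and> (AE x in lborel. f x = f' x) \<and> 0 \<le> B \<and>
        sobolev_seminorm \<alpha>\<^sub>2 p\<^sub>2 f = ennreal (B powr (1 / p\<^sub>2)) \<and>
        (\<forall>\<Lambda>>0. (\<integral>\<^sup>+z. shell \<Lambda> (gagliardo_kernel \<alpha>\<^sub>0 p\<^sub>0 f' z) (gagliardo_kernel \<alpha>\<^sub>2 p\<^sub>2 f' z) \<partial>(lborel \<Otimes>\<^sub>M lborel))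
        \<le> ennreal (k * B))"
        using B sem eq True by (intro exI[of _ f'] exI[of _ B]) auto
    qed (rule k)
  qed
qed

theorem lemma3p3:
  fixes \<alpha>\<^sub>0 \<alpha>\<^sub>1 \<alpha>\<^sub>2 p\<^sub>0 p\<^sub>1 p\<^sub>2 \<theta> :: real
  assumes "0 < \<alpha>\<^sub>0" and "\<alpha>\<^sub>0 < \<alpha>\<^sub>1" and "\<alpha>\<^sub>1 < \<alpha>\<^sub>2" and "\<alpha>\<^sub>2 \<le> 1"
    and "1 \<le> p\<^sub>0" and "1 \<le> p\<^sub>2"
    and "\<alpha>\<^sub>0 - 1 / p\<^sub>0 < \<alpha>\<^sub>2 - 1 / p\<^sub>2"
    and "\<theta> = (\<alpha>\<^sub>2 - \<alpha>\<^sub>1) / (\<alpha>\<^sub>2 - \<alpha>\<^sub>0)"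
    and "1 / p\<^sub>1 = \<theta> / p\<^sub>0 + (1 - \<theta>) / p\<^sub>2"
  shows "\<exists>C::real. C > 0 \<and>
    (\<forall>f :: real^'n \<Rightarrow> real. f \<in> sobolev_space \<alpha>\<^sub>0 p\<^sub>0 \<inter> sobolev_space \<alpha>\<^sub>2 p\<^sub>2 \<longrightarrow>
       sobolev_seminorm \<alpha>\<^sub>1 p\<^sub>1 f \<le>
         ennreal C
         * ennreal_powr (sobolev_seminorm \<alpha>\<^sub>0 p\<^sub>0 f) ((\<alpha>\<^sub>2 - \<alpha>\<^sub>1) / (\<alpha>\<^sub>2 - \<alpha>\<^sub>0))
         * ennreal_powr (sobolev_seminorm \<alpha>\<^sub>2 p\<^sub>2 f) ((\<alpha>\<^sub>1 - \<alpha>\<^sub>0) / (\<alpha>\<^sub>2 - \<alpha>\<^sub>0)))"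
proof -
  note p = \<open>1 \<le> p\<^sub>0\<close> \<open>1 \<le> p\<^sub>2\<close>
  have \<theta>: "0 < \<theta>" "\<theta> < 1" "(\<alpha>\<^sub>1 - \<alpha>\<^sub>0) / (\<alpha>\<^sub>2 - \<alpha>\<^sub>0) = 1 - \<theta>"
    using assms(2,3) by (simp_all add: assms(8) field_simps)
  have \<alpha>: "\<alpha>\<^sub>0 * \<theta> + \<alpha>\<^sub>2 * (1 - \<theta>) = \<alpha>\<^sub>1"
  proof -
    have "\<theta> * (\<alpha>\<^sub>2 - \<alpha>\<^sub>0) = \<alpha>\<^sub>2 - \<alpha>\<^sub>1" using assms(2,3) by (simp add: assms(8))
    then show ?thesis by (simp add: algebra_simps)
  qed
  have "0 < 1 / p\<^sub>1" unfolding assms(9) using \<theta> p by (intro add_pos_pos divide_pos_pos) auto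
  then have p1: "0 < p\<^sub>1" by simp
  \<comment> \<open>The weight for which the two terms of \<open>1 / p\<^sub>1\<close>, multiplied
    by \<open>p\<^sub>1\<close>, are \<sigma> and \<open>1 - \<sigma>\<close>.\<close>
  define \<sigma> where "\<sigma> = \<theta> * p\<^sub>1 / p\<^sub>0"
  have "p\<^sub>1 * (\<theta> / p\<^sub>0 + (1 - \<theta>) / p\<^sub>2) = 1" using assms(9) p1 by (metis less_irrefl nonzero_mult_div_cancel_left times_divide_eq_right mult.right_neutral)
  then have \<sigma>': "1 - \<sigma> = (1 - \<theta>) * p\<^sub>1 / p\<^sub>2" by (simp add: \<sigma>_def algebra_simps)
  have \<sigma>: "0 < \<sigma>" "\<sigma> < 1"
  proof -
    show "0 < \<sigma>" using \<theta> p p1 by (simp add: \<sigma>_def)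
    have "0 < (1 - \<theta>) * p\<^sub>1 / p\<^sub>2" using \<theta> p p1 by simp
    then show "\<sigma> < 1" using \<sigma>' by simp
  qed
  have p\<sigma>: "p\<^sub>0 * \<sigma> = p\<^sub>1 * \<theta>" "p\<^sub>2 * (1 - \<sigma>) = p\<^sub>1 * (1 - \<theta>)"
    unfolding \<sigma>' using p by (simp_all add: \<sigma>_def)
  have e1: "p\<^sub>0 * \<sigma> + p\<^sub>2 * (1 - \<sigma>) = p\<^sub>1" unfolding p\<sigma> by (simp add: algebra_simps)
  have e2: "\<alpha>\<^sub>0 * p\<^sub>0 * \<sigma> + \<alpha>\<^sub>2 * p\<^sub>2 * (1 - \<sigma>) = \<alpha>\<^sub>1 * p\<^sub>1"
    unfolding mult.assoc p\<sigma> \<alpha>[symmetric] by (simp add: algebra_simps)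
  obtain k where k: "k > 0" and shells: "\<And>f :: real^'n \<Rightarrow> real. f \<in> sobolev_space \<alpha>\<^sub>2 p\<^sub>2 \<Longrightarrow>
    (\<exists>f' B. f' \<in> borel_measurable borel \<and> (AE x in lborel. f x = f' x) \<and> 0 \<le> B \<and>
      sobolev_seminorm \<alpha>\<^sub>2 p\<^sub>2 f = ennreal (B powr (1 / p\<^sub>2)) \<and>
      (\<forall>\<Lambda>>0. (\<integral>\<^sup>+z. shell \<Lambda> (gagliardo_kernel \<alpha>\<^sub>0 p\<^sub>0 f' z) (gagliardo_kernel \<alpha>\<^sub>2 p\<^sub>2 f' z) \<partial>(lborel \<Otimes>\<^sub>M lborel))
        \<le> ennreal (k * B)))"
    using sobolev_shell_bound[OF assms(1) less_trans[OF assms(2,3)] assms(4-7), where 'n='n] by blast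
  define C where "C = (shell_const \<sigma> * k powr (1 - \<sigma>)) powr (1 / p\<^sub>1)"
  show ?thesis
  proof (intro exI[of _ C] conjI allI impI)
    show "C > 0" using shell_const_pos[OF \<sigma>(1)] k by (simp add: C_def)
    fix f :: "real^'n \<Rightarrow> real" assume f: "f \<in> sobolev_space \<alpha>\<^sub>0 p\<^sub>0 \<inter> sobolev_space \<alpha>\<^sub>2 p\<^sub>2"
    then obtain f' B where f' [measurable]: "f' \<in> borel_measurable borel" and eq: "AE x in lborel. f x = f' x"
      and B: "0 \<le> B" "sobolev_seminorm \<alpha>\<^sub>2 p\<^sub>2 f = ennreal (B powr (1 / p\<^sub>2))"
      and shell: "\<And>\<Lambda>. \<Lambda> > 0 \<Longrightarrow> (\<integral>\<^sup>+z. shell \<Lambda> (gagliardo_kernel \<alpha>\<^sub>0 p\<^sub>0 f' z) (gagliardo_kernel \<alpha>\<^sub>2 p\<^sub>2 f' z) \<partial>(lborel \<Otimes>\<^sub>M lborel))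
        \<le> ennreal (k * B)"
      using shells by blast
    let ?K = "\<lambda>\<alpha> p. \<integral>\<^sup>+z. ennreal (gagliardo_kernel \<alpha> p f' z) \<partial>(lborel \<Otimes>\<^sub>M lborel)"
    have sem: "sobolev_seminorm \<alpha> p f = ennreal_powr (?K \<alpha> p) (1 / p)" if "\<alpha> < 1" for \<alpha> p
      using that by (simp add: sobolev_seminorm_def gagliardo_seminorm_eq[OF f' eq])
    \<comment> \<open>The orders below 1 always carry the Gagliardo seminorm; only
      \<open>\<alpha>\<^sub>2\<close> can reach the gradient case.\<close>
    have \<alpha>1: "\<alpha>\<^sub>0 < 1" "\<alpha>\<^sub>1 < 1" using assms(2-4) by auto
    have "ennreal_powr (?K \<alpha>\<^sub>0 p\<^sub>0) (1 / p\<^sub>0) < top"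
      using f sem[OF \<alpha>1(1), of p\<^sub>0] by (simp add: sobolev_space_def)
    then obtain A where A: "0 \<le> A" "?K \<alpha>\<^sub>0 p\<^sub>0 = ennreal A" "ennreal_powr (?K \<alpha>\<^sub>0 p\<^sub>0) (1 / p\<^sub>0) = ennreal (A powr (1 / p\<^sub>0))"
      by (rule ennreal_powr_finite)
    define T where "T = shell_const \<sigma> * A powr \<sigma> * (k * B) powr (1 - \<sigma>)"
    have T: "0 \<le> T" using shell_const_pos[OF \<sigma>(1)] by (simp add: T_def)
    have "?K \<alpha>\<^sub>1 p\<^sub>1 = (\<integral>\<^sup>+z. ennreal (gagliardo_kernel \<alpha>\<^sub>0 p\<^sub>0 f' z powr \<sigma> * gagliardo_kernel \<alpha>\<^sub>2 p\<^sub>2 f' z powr (1 - \<sigma>)) \<partial>(lborel \<Otimes>\<^sub>M lborel))"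
      by (simp only: gagliardo_kernel_interpolate[OF e1 e2])
    also have "\<dots> \<le> ennreal T"
      unfolding T_def
    proof (rule nn_integral_geometric_mean_le[OF \<sigma>])
      show "(\<integral>\<^sup>+z. (if \<Lambda> * gagliardo_kernel \<alpha>\<^sub>2 p\<^sub>2 f' z < gagliardo_kernel \<alpha>\<^sub>0 p\<^sub>0 f' z \<and>
          gagliardo_kernel \<alpha>\<^sub>0 p\<^sub>0 f' z \<le> 2 * \<Lambda> * gagliardo_kernel \<alpha>\<^sub>2 p\<^sub>2 f' z
        then ennreal (gagliardo_kernel \<alpha>\<^sub>2 p\<^sub>2 f' z) else 0) \<partial>(lborel \<Otimes>\<^sub>M lborel)) \<le> ennreal (k * B)"
        if "0 < \<Lambda>" for \<Lambda> using shell[OF that] unfolding shell_def .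
    qed (use A B k in \<open>simp_all add: gagliardo_kernel_nonneg\<close>)
    finally obtain D where D: "0 \<le> D" "?K \<alpha>\<^sub>1 p\<^sub>1 = ennreal D" "D \<le> T"
      using T by (cases "?K \<alpha>\<^sub>1 p\<^sub>1") (auto simp: top_unique)
    have "sobolev_seminorm \<alpha>\<^sub>1 p\<^sub>1 f = ennreal (D powr (1 / p\<^sub>1))"
      unfolding sem[OF \<alpha>1(2)] D(2) using D(1) by (simp add: ennreal_powr_def)
    also have "\<dots> \<le> ennreal (T powr (1 / p\<^sub>1))"
      using D p1 by (intro ennreal_leI powr_mono2) auto
    also have "T powr (1 / p\<^sub>1) = C * (A powr (\<sigma> / p\<^sub>1)) * (B powr ((1 - \<sigma>) / p\<^sub>1))"
      using shell_const_pos[OF \<sigma>(1)] k A B by (simp add: T_def C_def powr_mult powr_powr mult_ac)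
    \<comment> \<open>Taking the \<open>p\<^sub>1\<close>-th root converts \<sigma> back to
      \<theta>: the integrals \<open>A\<close> and \<open>B\<close> are powers
      \<open>p\<^sub>0\<close> and \<open>p\<^sub>2\<close> of the seminorms.\<close>
    also have "\<sigma> / p\<^sub>1 = 1 / p\<^sub>0 * \<theta>" using p1 by (simp add: \<sigma>_def)
    also have "(1 - \<sigma>) / p\<^sub>1 = 1 / p\<^sub>2 * (1 - \<theta>)" unfolding \<sigma>' using p1 by simp
    also have "ennreal (C * A powr (1 / p\<^sub>0 * \<theta>) * B powr (1 / p\<^sub>2 * (1 - \<theta>))) =
        ennreal C * ennreal_powr (sobolev_seminorm \<alpha>\<^sub>0 p\<^sub>0 f) \<theta> * ennreal_powr (sobolev_seminorm \<alpha>\<^sub>2 p\<^sub>2 f) (1 - \<theta>)"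
      unfolding sem[OF \<alpha>1(1)] A(3) B(2) by (simp add: ennreal_powr_def powr_powr ennreal_mult C_def)
    finally show "sobolev_seminorm \<alpha>\<^sub>1 p\<^sub>1 f \<le>
         ennreal C
         * ennreal_powr (sobolev_seminorm \<alpha>\<^sub>0 p\<^sub>0 f) ((\<alpha>\<^sub>2 - \<alpha>\<^sub>1) / (\<alpha>\<^sub>2 - \<alpha>\<^sub>0))
         * ennreal_powr (sobolev_seminorm \<alpha>\<^sub>2 p\<^sub>2 f) ((\<alpha>\<^sub>1 - \<alpha>\<^sub>0) / (\<alpha>\<^sub>2 - \<alpha>\<^sub>0))"
      unfolding \<theta>(3) assms(8)[symmetric] .
  qed
qed

end
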